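(* Let $\Gamma$ be the signed graph obtained from the signed graph $\tilde W$ (defined in the context) by adding a negative edge $uv$, and let $\mathcal I=(\Gamma,u,v)$. Let $\Omega=K_4(\mathcal I)$ be the signed graph obtained from the complete graph $K_4$ by replacing each edge with a copy of $\mathcal I$. Then $\Omega$ is a signed planar simple graph with $\chi_c(\Omega)=\frac{14}{3}$.
   Context: Circular coloring: a signed graph $(G,\sigma)$ is a graph $G$ with a signature $\sigma:E(G)\to\{+,-\}$. For real $r\ge 1$, $C^r$ is the circle of circumference $r$, $d_{(\mathrm{mod}\, r)}(x,y)$ is the length of the shorter arc between $x$ and $y$, and $\bar x$ is the point at distance $r/2$ from $x$. A circular $r$-coloring of $(G,\sigma)$ is a map $f:V(G)\to C^r$ with $d_{(\mathrm{mod}\, r)}(f(a),f(b))\ge 1$ for each positive edge $ab$ and $d_{(\mathrm{mod}\, r)}(f(a),\overline{f(b)})\ge 1$ for each negative edge $ab$. $\chi_c(G,\sigma)$ is the infimum of those $r\ge1$ for which a circular $r$-coloring exists. Mini-gadget $(T,\pi)$: vertices $x,y,z,a,b,c$; positive edges $ab,bc,ac,ax,by,cz$; negative edges $xy,yz,zx,az,bx,cy$. Let $(T,\pi')$ be obtained by switching at $z$ (reversing the signs of all edges at $z$): positive edges $ab,bc,ac,ax,by,az,xz,yz$; negative edges $xy,bx,cy,cz$. Signed Wenger graph: vertices $w,x_1,\dots,x_5,z,t,u,v$. Positive edges: $wx_i$ ($1\le i\le 5$), $x_1x_2,x_2x_3,x_3x_4,x_4x_5,x_5x_1$, $zx_3$,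 $tx_5$, $vz$, $vt$, $vx_3$, $ux_1$, $ux_2$. Negative edges: $zx_2$, $tx_4$, $vx_4$, $ux_5$, $ut$, $uz$. It is a planar graph, and $ux_1x_5$, $zx_2x_3$, $vx_3x_4$, $tx_4x_5$ are facial triangles, each with exactly one negative edge (respectively $ux_5$, $zx_2$, $vx_4$, $tx_4$). $\tilde W$: obtained from the signed Wenger graph by completing each of these four negative facial triangles to a switching of the mini-gadget; that is, for each such triangle with negative edge $pq$ and third vertex $s$, add a new disjoint copy of $(T,\pi')$ and identify its triangle $xyz$ with the triangle by identifying its vertex $z$ with $s$ and its vertices $x,y$ with $p,q$ (in either order), so that three new vertices are added inside the face. Replacing an edge $e=ab$ of a graph with a copy of $\mathcal I=(\Gamma,u,v)$ means: delete $e$, add a disjoint copy of $\Gamma$, and identify $a$ with $u$ and $b$ with $v$ (the orientation of the edge may be chosen arbitrarily). *)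

theory Defs
  imports "HOL-Analysis.Analysis"
begin

text \<open>Undirected multigraphs: edges have an identity and a set of ends, so that parallel edges
  and loops (one-element sets of ends) are possible and simplicity is a genuine property.\<close>

record ('v, 'e) graph =
  verts :: "'v set"
  edges :: "'e set"
  ends :: "'e \<Rightarrow> 'v set"

datatype sign = Plus | Minus

record ('v, 'e) sgraph = "('v, 'e) graph" +
  sig :: "'e \<Rightarrow> sign"

definition finite_graph :: "('v, 'e, 'm) graph_scheme \<Rightarrow> bool" where
  "finite_graph G \<longleftrightarrow> finite (verts G) \<and> finite (edges G) \<and>
     (\<forall>e\<in>edges G. ends G e \<subseteq> verts G \<and> card (ends G e) \<in> {1, 2})"

definition simple_graph :: "('v, 'e, 'm) graph_scheme \<Rightarrow> bool" where
  "simple_graph G \<longleftrightarrow> (\<forall>e\<in>edges G. card (ends G e) = 2) \<and> inj_on (ends G) (edges G)"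

text \<open>A drawing in the plane: vertices are distinct points, edges are simple curves joining
  their ends (simple closed curves for loops), and curves meet vertices and each other only in
  common ends.\<close>

definition planar :: "('v, 'e, 'm) graph_scheme \<Rightarrow> bool" where
  "planar G \<longleftrightarrow> (\<exists>(p :: 'v \<Rightarrow> real \<times> real) (\<gamma> :: 'e \<Rightarrow> real \<Rightarrow> real \<times> real).
     inj_on p (verts G) \<and>
     (\<forall>e\<in>edges G. simple_path (\<gamma> e) \<and>
        {pathstart (\<gamma> e), pathfinish (\<gamma> e)} = p ` ends G e \<and>
        path_image (\<gamma> e) \<inter> p ` verts G = p ` ends G e) \<and>
     (\<forall>e\<in>edges G. \<forall>e'\<in>edges G. e \<noteq> e' \<longrightarrow>
        path_image (\<gamma> e) \<inter> path_image (\<gamma> e') \<subseteq> p ` (ends G e \<inter> ends G e')))"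

text \<open>The circle of circumference r is represented by the interval from 0 (included) to r
  (excluded).\<close>

definition circle :: "real \<Rightarrow> real set" where
  "circle r = {0..<r}"

definition circ_dist :: "real \<Rightarrow> real \<Rightarrow> real \<Rightarrow> real" where
  "circ_dist r x y = min \<bar>x - y\<bar> (r - \<bar>x - y\<bar>)"

definition antipode :: "real \<Rightarrow> real \<Rightarrow> real" where
  "antipode r x = (if x < r / 2 then x + r / 2 else x - r / 2)"

definition circular_coloring :: "real \<Rightarrow> ('v, 'e) sgraph \<Rightarrow> ('v \<Rightarrow> real) \<Rightarrow> bool" where
  "circular_coloring r G f \<longleftrightarrow> f ` verts G \<subseteq> circle r \<and>
     (\<forall>e\<in>edges G. \<forall>a b. ends G e = {a, b} \<longrightarrow>
        (case sig G e of
           Plus \<Rightarrow> circ_dist r (f a) (f b) \<ge> 1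
         | Minus \<Rightarrow> circ_dist r (f a) (antipode r (f b)) \<ge> 1))"

definition circular_chromatic_number :: "('v, 'e) sgraph \<Rightarrow> real" where
  "circular_chromatic_number G = Inf {r. r \<ge> 1 \<and> (\<exists>f. circular_coloring r G f)}"

text \<open>Signed graphs without parallel edges, every edge being its own set of ends.\<close>

definition sgraph_of :: "'v set \<Rightarrow> 'v set set \<Rightarrow> 'v set set \<Rightarrow> ('v, 'v set) sgraph" where
  "sgraph_of V P N =
     \<lparr>verts = V, edges = P \<union> N, ends = (\<lambda>e. e), sig = (\<lambda>e. if e \<in> N then Minus else Plus)\<rparr>"

definition edges_of_sign :: "sign \<Rightarrow> ('v, 'e) sgraph \<Rightarrow> 'e set" where
  "edges_of_sign s G = {e \<in> edges G. sig G e = s}"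

primrec opposite :: "sign \<Rightarrow> sign" where
  "opposite Plus = Minus"
| "opposite Minus = Plus"

text \<open>A loop at the switched vertex keeps its sign, as it is reversed twice.\<close>

definition switch :: "'v \<Rightarrow> ('v, 'e) sgraph \<Rightarrow> ('v, 'e) sgraph" where
  "switch x G = G\<lparr>sig := (\<lambda>e. if x \<in> ends G e \<and> ends G e \<noteq> {x}
                                then opposite (sig G e) else sig G e)\<rparr>"

text \<open>The new edge is \<^term>\<open>None\<close>, even if there already is an edge with the same ends.\<close>

definition add_edge :: "'v \<Rightarrow> 'v \<Rightarrow> sign \<Rightarrow> ('v, 'e) sgraph \<Rightarrow> ('v, 'e option) sgraph" where
  "add_edge a b s G =
     \<lparr>verts = verts G, edges = insert None (Some ` edges G),
      ends = (\<lambda>e. case e of None \<Rightarrow> {a, b} | Some e' \<Rightarrow> ends G e'),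
      sig = (\<lambda>e. case e of None \<Rightarrow> s | Some e' \<Rightarrow> sig G e')\<rparr>"

definition complete_graph :: "'v set \<Rightarrow> ('v, 'v set) graph" where
  "complete_graph V = \<lparr>verts = V, edges = {e. e \<subseteq> V \<and> card e = 2}, ends = (\<lambda>e. e)\<rparr>"

definition orientation :: "('v, 'e, 'm) graph_scheme \<Rightarrow> ('e \<Rightarrow> 'v \<times> 'v) \<Rightarrow> bool" where
  "orientation G d \<longleftrightarrow> (\<forall>e\<in>edges G. ends G e = {fst (d e), snd (d e)})"

text \<open>The vertex x of the copy of H placed at the edge e becomes \<^term>\<open>Inr (e, x)\<close>, unless it is one
  of the two terminals u, v of H, which are identified with the first and the second end of e in
  the orientation d.\<close>

definition replace_vertex ::
  "('e \<Rightarrow> 'v \<times> 'v) \<Rightarrow> 'w \<Rightarrow> 'w \<Rightarrow> 'e \<Rightarrow> 'w \<Rightarrow> 'v + 'e \<times> 'w" where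
  "replace_vertex d u v e x =
     (if x = u then Inl (fst (d e)) else if x = v then Inl (snd (d e)) else Inr (e, x))"

definition replace_edges ::
  "('v, 'e) graph \<Rightarrow> ('e \<Rightarrow> 'v \<times> 'v) \<Rightarrow> ('w, 'f) sgraph \<Rightarrow> 'w \<Rightarrow> 'w
     \<Rightarrow> ('v + 'e \<times> 'w, 'e \<times> 'f) sgraph" where
  "replace_edges G d H u v =
     \<lparr>verts = Inl ` verts G \<union> Inr ` (edges G \<times> (verts H - {u, v})),
      edges = edges G \<times> edges H,
      ends = (\<lambda>(e, g). replace_vertex d u v e ` ends H g),
      sig = (\<lambda>(e, g). sig H g)\<rparr>"

datatype gadget_vertex = Gx | Gy | Gz | Ga | Gb | Gc

definition mini_gadget :: "(gadget_vertex, gadget_vertex set) sgraph" where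
  "mini_gadget = sgraph_of UNIV
     {{Ga,Gb}, {Gb,Gc}, {Ga,Gc}, {Ga,Gx}, {Gb,Gy}, {Gc,Gz}}
     {{Gx,Gy}, {Gy,Gz}, {Gz,Gx}, {Ga,Gz}, {Gb,Gx}, {Gc,Gy}}"

definition mini_gadget' :: "(gadget_vertex, gadget_vertex set) sgraph" where
  "mini_gadget' = switch Gz mini_gadget"

lemma edges_mini_gadget':
  "edges_of_sign Plus mini_gadget' =
     {{Gy,Gz}, {Gz,Gx}, {Ga,Gz}, {Ga,Gb}, {Gb,Gc}, {Ga,Gc}, {Ga,Gx}, {Gb,Gy}}" (is ?P)
  "edges_of_sign Minus mini_gadget' = {{Gx,Gy}, {Gb,Gx}, {Gc,Gy}, {Gc,Gz}}" (is ?M)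
proof -
  have filter_insert: "{e \<in> insert a A. Q e} = (if Q a then insert a {e \<in> A. Q e} else {e \<in> A. Q e})"
    for a :: "gadget_vertex set" and A Q
    by auto
  have filter_empty: "{e \<in> {}. Q e} = {}" for Q :: "gadget_vertex set \<Rightarrow> bool"
    by simp
  have U: "edges mini_gadget' =
     {{Gx,Gy}, {Gy,Gz}, {Gz,Gx}, {Ga,Gz}, {Gb,Gx}, {Gc,Gy},
      {Ga,Gb}, {Gb,Gc}, {Ga,Gc}, {Ga,Gx}, {Gb,Gy}, {Gc,Gz}}"
    by (simp add: mini_gadget'_def mini_gadget_def switch_def sgraph_of_def)
  have S: "sig mini_gadget' e =
      (if Gz \<in> e \<and> e \<noteq> {Gz} then opposite (sig mini_gadget e) else sig mini_gadget e)"
    "sig mini_gadget e =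
      (if e \<in> {{Gx,Gy}, {Gy,Gz}, {Gz,Gx}, {Ga,Gz}, {Gb,Gx}, {Gc,Gy}} then Minus else Plus)" for e
    by (simp_all only: mini_gadget'_def mini_gadget_def switch_def sgraph_of_def
        graph.simps sgraph.simps)
  have ne: "Gz \<in> {a, b} \<and> {a, b} \<noteq> {Gz} \<longleftrightarrow> (a = Gz) \<noteq> (b = Gz)" for a b
    by auto
  show ?P
    unfolding edges_of_sign_def U filter_insert filter_empty S ne
    by (simp add: doubleton_eq_iff)
  show ?M
    unfolding edges_of_sign_def U filter_insert filter_empty S ne
    by (simp add: doubleton_eq_iff)
qed

datatype wenger_vertex = Ww | X1 | X2 | X3 | X4 | X5 | Wz | Wt | Wu | Wv

definition wenger :: "(wenger_vertex, wenger_vertex set) sgraph" where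
  "wenger = sgraph_of UNIV
     {{Ww,X1}, {Ww,X2}, {Ww,X3}, {Ww,X4}, {Ww,X5},
      {X1,X2}, {X2,X3}, {X3,X4}, {X4,X5}, {X5,X1},
      {Wz,X3}, {Wt,X5}, {Wv,Wz}, {Wv,Wt}, {Wv,X3}, {Wu,X1}, {Wu,X2}}
     {{Wz,X2}, {Wt,X4}, {Wv,X4}, {Wu,X5}, {Wu,Wt}, {Wu,Wz}}"

text \<open>The four negative facial triangles, written (p, q, s) with negative edge pq.\<close>

type_synonym triangle = "wenger_vertex \<times> wenger_vertex \<times> wenger_vertex"

definition negative_triangles :: "triangle set" where
  "negative_triangles = {(Wu,X5,X1), (Wz,X2,X3), (Wv,X4,X3), (Wt,X4,X5)}"

text \<open>Where the vertices of the copy of the gadget at the triangle (p, q, s) go: z to s, and x, y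
  to p, q if the flag is False and to q, p if it is True. In \<open>wenger_tilde\<close>, the flag may
  be chosen independently for the four triangles.\<close>

fun glue_vertex ::
  "bool \<Rightarrow> triangle \<Rightarrow> gadget_vertex \<Rightarrow> wenger_vertex + triangle \<times> gadget_vertex" where
  "glue_vertex flip (p, q, s) Gx = Inl (if flip then q else p)"
| "glue_vertex flip (p, q, s) Gy = Inl (if flip then p else q)"
| "glue_vertex flip (p, q, s) Gz = Inl s"
| "glue_vertex flip t g = Inr (t, g)"

text \<open>Edges are their sets of ends here, so the edges of the triangle xyz of a gadget are identified
  with those of the facial triangle. By \<open>glue_signs_agree\<close> below, their signs agree.\<close>

definition wenger_tilde :: "(triangle \<Rightarrow> bool) \<Rightarrow>
    (wenger_vertex + triangle \<times> gadget_vertex,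
     (wenger_vertex + triangle \<times> gadget_vertex) set) sgraph" where
  "wenger_tilde flip = sgraph_of
     (Inl ` verts wenger \<union> Inr ` (negative_triangles \<times> {Ga, Gb, Gc}))
     ((`) Inl ` edges_of_sign Plus wenger \<union>
       (\<Union>t\<in>negative_triangles. (`) (glue_vertex (flip t) t) ` edges_of_sign Plus mini_gadget'))
     ((`) Inl ` edges_of_sign Minus wenger \<union>
       (\<Union>t\<in>negative_triangles. (`) (glue_vertex (flip t) t) ` edges_of_sign Minus mini_gadget'))"

lemma glue_signs_agree:
  assumes "(p, q, s) \<in> negative_triangles"
  shows "{p, q} \<in> edges_of_sign Minus wenger \<and>
    {p, s} \<in> edges_of_sign Plus wenger \<and> {q, s} \<in> edges_of_sign Plus wenger"
proof -
  consider "p = Wu" "q = X5" "s = X1" | "p = Wz" "q = X2" "s = X3"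
    | "p = Wv" "q = X4" "s = X3" | "p = Wt" "q = X4" "s = X5"
    using assms by (simp add: negative_triangles_def) blast
  then show ?thesis
    by cases (simp_all add: edges_of_sign_def wenger_def sgraph_of_def doubleton_eq_iff)
qed

definition Gamma_graph :: "(triangle \<Rightarrow> bool) \<Rightarrow>
    (wenger_vertex + triangle \<times> gadget_vertex,
     (wenger_vertex + triangle \<times> gadget_vertex) set option) sgraph" where
  "Gamma_graph flip = add_edge (Inl Wu) (Inl Wv) Minus (wenger_tilde flip)"

abbreviation K4 :: "(nat, nat set) graph" where
  "K4 \<equiv> complete_graph {0..<4}"

definition Omega_graph :: "(triangle \<Rightarrow> bool) \<Rightarrow> (nat set \<Rightarrow> nat \<times> nat) \<Rightarrow>
    (nat + nat set \<times> (wenger_vertex + triangle \<times> gadget_vertex),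
     nat set \<times> (wenger_vertex + triangle \<times> gadget_vertex) set option) sgraph" where
  "Omega_graph flip d = replace_edges K4 d (Gamma_graph flip) (Inl Wu) (Inl Wv)"

end

theory Submission
  imports Defs
begin

text \<open>Colour every vertex of \<open>K\<^sub>4\<close> alike: \<open>\<Gamma>\<close> has a circular \<open>14/3\<close>-coloring in which u and v
  have the same colour, so \<open>\<Omega>\<close> has a \<open>14/3\<close>-coloring. Conversely, rescale a circular r-coloring
  with \<open>r < 14/3\<close> to the circle of circumference 14; then the ends of positive edges have distance
  greater than 3, and the ends of negative edges have distance less than 4. The mini-gadget forbids
  that \<open>x\<close>, \<open>y\<close> and the antipode of \<open>z\<close> have pairwise distances less than 2, and this makes the
  signed Wenger graph force a distance of at least 2 between u and v, while the negative edge uv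
  keeps it below 4. Three points of a circle of circumference 14 cannot have all their distances
  in \<open>[2, 4)\<close>: they would lie on an arc of length less than 4.

  For planarity, \<open>\<Gamma>\<close> is a triangulation, drawn with straight edges in a triangle two of whose
  corners are u and v. Affine copies of that triangle are placed along the edges of a straight-line
  drawing of \<open>K\<^sub>4\<close> so that they meet only in the vertices of \<open>K\<^sub>4\<close>.\<close>

section \<open>Edges of the signed Wenger graph with gadgets\<close>

text \<open>\<open>sgraph_of\<close> lets the negative list win on common edges, hence the set
  difference for Plus.\<close>

lemma edges_of_sign_sgraph_of:
  "edges_of_sign Plus (sgraph_of V P N) = P - N" "edges_of_sign Minus (sgraph_of V P N) = N"
  by (auto simp: edges_of_sign_def sgraph_of_def split: if_splits)

lemma edges_of_sign_Plus_wenger: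
  "edges_of_sign Plus wenger =
     {{Ww,X1}, {Ww,X2}, {Ww,X3}, {Ww,X4}, {Ww,X5},
      {X1,X2}, {X2,X3}, {X3,X4}, {X4,X5}, {X5,X1},
      {Wz,X3}, {Wt,X5}, {Wv,Wz}, {Wv,Wt}, {Wv,X3}, {Wu,X1}, {Wu,X2}}"
  unfolding wenger_def edges_of_sign_sgraph_of
  by (rule Diff_triv) (simp add: doubleton_eq_iff)

lemma edges_of_sign_Minus_wenger:
  "edges_of_sign Minus wenger = {{Wz,X2}, {Wt,X4}, {Wv,X4}, {Wu,X5}, {Wu,Wt}, {Wu,Wz}}"
  by (simp only: wenger_def edges_of_sign_sgraph_of)

lemmas edges_of_sign_wenger = edges_of_sign_Plus_wenger edges_of_sign_Minus_wenger

text \<open>The hypothesis guarantees that the three corners of the triangle are distinct; the inner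
  vertices keep their own names under \<open>Inr\<close>.\<close>

lemma inj_glue_vertex:
  assumes "t \<in> negative_triangles"
  shows "inj (glue_vertex b t)"
proof (rule injI)
  fix g h assume "glue_vertex b t g = glue_vertex b t h"
  then show "g = h"
    using assms by (cases g; cases h) (auto simp: negative_triangles_def split: if_splits)
qed

text \<open>By \<open>glue_signs_agree\<close>, a gadget edge on the triangle xyz contributes only
  an edge that the Wenger graph already has with the same sign.\<close>

lemma glue_vertex_outer:
  assumes "t \<in> negative_triangles" "E \<in> edges_of_sign s mini_gadget'" "E \<inter> {Ga, Gb, Gc} = {}"
  shows "glue_vertex b t ` E \<in> (`) Inl ` edges_of_sign s wenger"
proof -
  have E: "s = Plus \<and> E = {Gy, Gz} \<or> s = Plus \<and> E = {Gz, Gx} \<or> s = Minus \<and> E = {Gx, Gy}"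
    using assms(2,3) by (cases s) (auto simp: edges_mini_gadget')
  obtain p q r where t: "t = (p, q, r)" by (cases t)
  note signs = glue_signs_agree[OF assms(1)[unfolded t]]
  show ?thesis
    using E
  proof (elim disjE conjE)
    assume "s = Plus" "E = {Gy, Gz}"
    then show ?thesis
      by (intro image_eqI[of _ _ "{if b then p else q, r}"]) (use signs in \<open>simp_all add: t\<close>)
  next
    assume "s = Plus" "E = {Gz, Gx}"
    then show ?thesis
      by (intro image_eqI[of _ _ "{r, if b then q else p}"]) (use signs in \<open>simp_all add: t insert_commute\<close>)
  next
    assume "s = Minus" "E = {Gx, Gy}"
    then show ?thesis
      by (intro image_eqI[of _ _ "{p, q}"]) (use signs in \<open>simp_all add: t insert_commute\<close>)
  qed
qed

lemma glue_vertex_inner: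
  assumes "E \<inter> {Ga, Gb, Gc} \<noteq> {}"
  shows "\<exists>g. Inr (t, g) \<in> glue_vertex b t ` E"
proof -
  obtain g where g: "g \<in> E" "g \<in> {Ga, Gb, Gc}" using assms by blast
  then have "Inr (t, g) = glue_vertex b t g" by (cases t) auto
  then show ?thesis using g(1) by blast
qed

lemma glue_vertex_eq_Inr: "glue_vertex b t h = Inr (t', g) \<Longrightarrow> t = t'"
  by (cases t; cases h) auto

text \<open>An inner vertex carries its triangle as a tag, so an edge with an inner end reveals the
  gadget from which it comes.\<close>

lemma glue_vertex_inner_eq:
  assumes "E \<inter> {Ga, Gb, Gc} \<noteq> {}" "glue_vertex b t ` E = glue_vertex b' t' ` E'"
  shows "t = t'"
proof -
  obtain g where "Inr (t, g) \<in> glue_vertex b' t' ` E'"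
    using glue_vertex_inner[OF assms(1), of t b] assms(2) by auto
  then obtain h where h: "glue_vertex b' t' h = Inr (t, g)" by (elim imageE) simp
  show ?thesis using glue_vertex_eq_Inr[OF h] by simp
qed

lemma glue_vertex_inner_ne:
  assumes "E \<inter> {Ga, Gb, Gc} \<noteq> {}"
  shows "glue_vertex b t ` E \<noteq> Inl ` F"
  using glue_vertex_inner[OF assms, of t b] by auto

text \<open>The sets for Plus and Minus are the two edge arguments of \<open>sgraph_of\<close> in
  \<open>wenger_tilde\<close>.\<close>

definition tilde_edges where
  "tilde_edges flip s = (`) Inl ` edges_of_sign s wenger \<union>
       (\<Union>t\<in>negative_triangles. (`) (glue_vertex (flip t) t) ` edges_of_sign s mini_gadget')"

lemma edges_of_sign_unique: "e \<in> edges_of_sign s G \<Longrightarrow> e \<in> edges_of_sign s' G \<Longrightarrow> s = s'"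
  by (simp add: edges_of_sign_def)

text \<open>A normal form for the origin of an edge: edges of the glued triangles count as Wenger
  edges, so every remaining gadget edge has an inner end and the two cases exclude each
  other.\<close>

lemma tilde_edges_cases:
  assumes "e \<in> tilde_edges flip s"
  obtains F where "F \<in> edges_of_sign s wenger" "e = Inl ` F"
  | t E where "t \<in> negative_triangles" "E \<in> edges_of_sign s mini_gadget'"
     "E \<inter> {Ga, Gb, Gc} \<noteq> {}" "e = glue_vertex (flip t) t ` E"
proof -
  consider "e \<in> (`) Inl ` edges_of_sign s wenger"
    | t E where "t \<in> negative_triangles" "E \<in> edges_of_sign s mini_gadget'"
      "e = glue_vertex (flip t) t ` E"
    using assms unfolding tilde_edges_def by auto
  then show thesis
  proof cases
    case 1
    then show thesis by (elim imageE) (rule that(1))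
  next
    case (2 t E)
    show thesis
    proof (cases "E \<inter> {Ga, Gb, Gc} = {}")
      case True
      show thesis
        using glue_vertex_outer[OF 2(1,2) True, of "flip t"] unfolding 2(3)[symmetric]
        by (elim imageE) (rule that(1))
    next
      case False
      show thesis by (rule that(2)[OF 2(1,2) False 2(3)])
    qed
  qed
qed

text \<open>Without this, the priority of negative edges in \<open>sgraph_of\<close> could override
  the sign of a glued edge. The normal form of an edge is unique, so a conflict would already occur
  inside the Wenger graph or inside one gadget.\<close>

lemma tilde_edges_disjoint: "tilde_edges flip Plus \<inter> tilde_edges flip Minus = {}"
proof (rule equals0I)
  fix e assume "e \<in> tilde_edges flip Plus \<inter> tilde_edges flip Minus"
  then have e: "e \<in> tilde_edges flip Plus" "e \<in> tilde_edges flip Minus" by auto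
  have inl: "Inl ` F = (Inl ` F' :: (wenger_vertex + triangle \<times> gadget_vertex) set) \<Longrightarrow> F = F'" for F F'
    by (simp add: inj_image_eq_iff)
  from e(1) show False
  proof (cases rule: tilde_edges_cases)
    case F: (1 F)
    from e(2) show False
    proof (cases rule: tilde_edges_cases)
      case (1 F')
      have "F = F'" by (rule inl) (use F(2) 1(2) in simp)
      then show False using edges_of_sign_unique[of F Plus wenger Minus] F(1) 1(1) by simp
    next
      case (2 t E)
      then show False using F(2) glue_vertex_inner_ne[OF 2(3), of "flip t" t F] by simp
    qed
  next
    case E: (2 t E)
    from e(2) show False
    proof (cases rule: tilde_edges_cases)
      case (1 F')
      then show False using E(4) glue_vertex_inner_ne[OF E(3), of "flip t" t F'] by simp
    next
      case (2 t' E')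
      have eq: "glue_vertex (flip t) t ` E = glue_vertex (flip t') t' ` E'"
        using E(4) 2(4) by simp
      have "t = t'" by (rule glue_vertex_inner_eq[OF E(3) eq])
      then have "glue_vertex (flip t) t ` E = glue_vertex (flip t) t ` E'" using E(4) 2(4) by simp
      then have "E = E'"
        using inj_image_eq_iff[OF inj_glue_vertex[OF E(1)]] by simp
      then show False  using edges_of_sign_unique[of E Plus mini_gadget' Minus] E(2) 2(2) by simp
    qed
  qed
qed

lemma wenger_tilde_simps:
  "verts (wenger_tilde flip) = Inl ` UNIV \<union> Inr ` (negative_triangles \<times> {Ga, Gb, Gc})"
  "edges (wenger_tilde flip) = tilde_edges flip Plus \<union> tilde_edges flip Minus"
  "ends (wenger_tilde flip) = (\<lambda>e. e)"
  by (simp_all add: wenger_tilde_def tilde_edges_def sgraph_of_def wenger_def)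

lemma sig_wenger_tilde:
  assumes "e \<in> tilde_edges flip s"
  shows "sig (wenger_tilde flip) e = s"
proof -
  have "sig (wenger_tilde flip) e = (if e \<in> tilde_edges flip Minus then Minus else Plus)"
    unfolding wenger_tilde_def sgraph_of_def tilde_edges_def by simp
  then show ?thesis
    using assms tilde_edges_disjoint[of flip] by (cases s) auto
qed

section \<open>Lower bound\<close>

lemma circ_dist_ge_iff: "circ_dist r x y \<ge> 1 \<longleftrightarrow> 1 \<le> \<bar>x - y\<bar> \<and> \<bar>x - y\<bar> \<le> r - 1"
  by (auto simp: circ_dist_def)

text \<open>The distance of x from the antipode of y is r/2 minus the distance of x from y, so the
  condition bounds the latter by r/2 - 1.\<close>

lemma circ_dist_antipode_ge_iff:
  assumes "x \<in> {0..<r}" "y \<in> {0..<r}"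
  shows "circ_dist r x (antipode r y) \<ge> 1 \<longleftrightarrow> \<bar>x - y\<bar> \<le> r / 2 - 1 \<or> \<bar>x - y\<bar> \<ge> r / 2 + 1"
  using assms unfolding circ_dist_def antipode_def atLeastLessThan_iff
  by (cases "y < r / 2"; cases "x \<le> y"; simp add: min_def abs_if) linarith+

text \<open>The circle of circumference \<open>14/3\<close> is scaled to circumference 14, so that the unit becomes 3.
  The strict conditions are what a circular r-coloring with \<open>r < 14/3\<close> gives.\<close>

fun allowed :: "sign \<Rightarrow> real \<Rightarrow> real \<Rightarrow> bool" where
  "allowed Plus x y \<longleftrightarrow> 3 \<le> \<bar>x - y\<bar> \<and> \<bar>x - y\<bar> \<le> 11"
| "allowed Minus x y \<longleftrightarrow> \<bar>x - y\<bar> \<le> 4 \<or> \<bar>x - y\<bar> \<ge> 10"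

fun strictly_allowed :: "sign \<Rightarrow> real \<Rightarrow> real \<Rightarrow> bool" where
  "strictly_allowed Plus x y \<longleftrightarrow> 3 < \<bar>x - y\<bar> \<and> \<bar>x - y\<bar> < 11"
| "strictly_allowed Minus x y \<longleftrightarrow> \<bar>x - y\<bar> < 4 \<or> \<bar>x - y\<bar> > 10"

text \<open>Multiplication by 3 turns the bounds 1 and r - 1 = 11/3 into 3 and 11, and the bounds
  r/2 - 1 = 4/3 and r/2 + 1 = 10/3 into 4 and 10.\<close>

lemma circular_coloring_scaled:
  assumes "\<And>v. v \<in> verts G \<Longrightarrow> f v \<in> {0..<14}"
    and "\<And>e. e \<in> edges G \<Longrightarrow> ends G e \<subseteq> verts G"
    and "\<And>e a b. e \<in> edges G \<Longrightarrow> ends G e = {a, b} \<Longrightarrow> allowed (sig G e) (f a) (f b)"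
  shows "circular_coloring (14 / 3) G (\<lambda>v. f v / 3)"
  unfolding circular_coloring_def
proof (intro conjI ballI allI impI)
  show "(\<lambda>v. f v / 3) ` verts G \<subseteq> circle (14 / 3)"
    using assms(1) by (force simp: circle_def)
  fix e a b assume e: "e \<in> edges G" "ends G e = {a, b}"
  then have "a \<in> verts G" "b \<in> verts G" using assms(2) by auto
  then have ab: "f a \<in> {0..<14}" "f b \<in> {0..<14}" using assms(1) by auto
  then have c: "f a / 3 \<in> {0..<14/3}" "f b / 3 \<in> {0..<14/3}" by auto
  have d: "\<bar>f a / 3 - f b / 3\<bar> = \<bar>f a - f b\<bar> / 3" by (simp add: diff_divide_distrib[symmetric])
  show "case sig G e of Plus \<Rightarrow> 1 \<le> circ_dist (14 / 3) (f a / 3) (f b / 3)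
    | Minus \<Rightarrow> 1 \<le> circ_dist (14 / 3) (f a / 3) (antipode (14 / 3) (f b / 3))"
    using assms(3)[OF e]
    by (cases "sig G e")
      (auto simp only: allowed.simps sign.case circ_dist_antipode_ge_iff[OF c] d, auto simp: circ_dist_ge_iff d)
qed

lemma circular_coloring_strict:
  assumes "circular_coloring r G f" "1 \<le> r" "r < 14 / 3"
    and "e \<in> edges G" "ends G e = {a, b}" "{a, b} \<subseteq> verts G"
  shows "strictly_allowed (sig G e) (f a * (14 / r)) (f b * (14 / r))"
proof -
  have ab: "f a \<in> {0..<r}" "f b \<in> {0..<r}"
    using assms(1,6) by (auto simp: circular_coloring_def circle_def)
  \<comment> \<open>The only use of r < 14/3: the unit becomes longer than 3, which makes all four
    scaled bounds strict.\<close>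
  have r: "14 / r > 3" using assms(2,3) by (simp add: field_simps)
  have d: "\<bar>f a * (14 / r) - f b * (14 / r)\<bar> = \<bar>f a - f b\<bar> * (14 / r)"
    using assms(2) by (simp only: left_diff_distrib[symmetric] abs_mult) simp
  have *: "case sig G e of Plus \<Rightarrow> 1 \<le> circ_dist r (f a) (f b)
    | Minus \<Rightarrow> 1 \<le> circ_dist r (f a) (antipode r (f b))"
    using assms(1,4,5) by (auto simp: circular_coloring_def)
  have mono: "x \<le> y \<Longrightarrow> x * (14 / r) \<le> y * (14 / r)" for x y
    using assms(2) by (intro mult_right_mono) auto
  show ?thesis
  proof (cases "sig G e")
    case Plus
    then have "1 \<le> \<bar>f a - f b\<bar>" "\<bar>f a - f b\<bar> \<le> r - 1" using * by (auto simp: circ_dist_ge_iff)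
    from this[THEN mono] have "14 / r \<le> \<bar>f a - f b\<bar> * (14 / r)"
      "\<bar>f a - f b\<bar> * (14 / r) \<le> (r - 1) * (14 / r)" by (simp_all only: mult_1)
    moreover have "(r - 1) * (14 / r) = 14 - 14 / r"
      using assms(2) by (simp add: field_simps)
    ultimately have "3 < \<bar>f a - f b\<bar> * (14 / r)" "\<bar>f a - f b\<bar> * (14 / r) < 11"
      using r by linarith+
    then show ?thesis unfolding Plus strictly_allowed.simps d by blast
  next
    case Minus
    then have "\<bar>f a - f b\<bar> \<le> r / 2 - 1 \<or> r / 2 + 1 \<le> \<bar>f a - f b\<bar>"
      using * by (auto simp: circ_dist_antipode_ge_iff[OF ab])
    then have "\<bar>f a - f b\<bar> * (14 / r) \<le> (r / 2 - 1) * (14 / r)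
       \<or> (r / 2 + 1) * (14 / r) \<le> \<bar>f a - f b\<bar> * (14 / r)"
      using mono by blast
    moreover have "(r / 2 - 1) * (14 / r) = 7 - 14 / r" "(r / 2 + 1) * (14 / r) = 7 + 14 / r"
      using assms(2) by (simp_all add: field_simps)
    ultimately have "\<bar>f a - f b\<bar> * (14 / r) < 4 \<or> \<bar>f a - f b\<bar> * (14 / r) > 10"
      using r by linarith
    then show ?thesis unfolding Minus strictly_allowed.simps d .
  qed
qed

section \<open>Points at distance less than 2 and the mini-gadget\<close>

definition close :: "real \<Rightarrow> real \<Rightarrow> bool" where
  "close x y \<longleftrightarrow> \<bar>x - y\<bar> < 2 \<or> \<bar>x - y\<bar> > 12"

text \<open>On the circle of circumference 14, x is at distance less than 2 from the antipode of
  y.\<close>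

definition opposite_close :: "real \<Rightarrow> real \<Rightarrow> bool" where
  "opposite_close x y \<longleftrightarrow> 5 < \<bar>x - y\<bar> \<and> \<bar>x - y\<bar> < 9"

definition narrow :: "real \<Rightarrow> real \<Rightarrow> real \<Rightarrow> bool" where
  "narrow x y z \<longleftrightarrow> close x y \<and> opposite_close x z \<and> opposite_close y z"

abbreviation "far \<equiv> strictly_allowed Plus"
abbreviation "near \<equiv> strictly_allowed Minus"

text \<open>Let z' be the antipode of z and suppose that x, y, z' lie on an arc of length less than
  2. Then a is within 4 of z' but more than 3 from x, b is within 4 of x but more than 3 from y, and
  c is within 4 of y but more than 3 from z'. So each of a, b, c lies to the left or to the right of
  its excluded point, and two of them are on the same side. Comparing their bounds shows that these
  two are less than 3 apart, against the edges of the triangle abc. The solver settles the statement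
  as linear real arithmetic.\<close>

lemma not_narrow_mini_gadget:
  assumes "{x, y, z, a, b, c} \<subseteq> {0..<14}"
   and "far a b" "far b c" "far a c" "far a x" "far b y" "far a z"
   and "near b x" "near c y" "near c z"
  shows "\<not> narrow x y z"
  using assms unfolding strictly_allowed.simps close_def opposite_close_def narrow_def
  by simp (smt (z3))

text \<open>Seen from w, the rim x1, ..., x5 lies on an arc of length 8 with neighbours more than 3
  apart. The rim cycle is odd, so some three consecutive rim points occur in monotone order along
  this arc and the outer two are nearly antipodal. Placing u, v, z, t around them is a finite case
  distinction on linear inequalities; the solver decides the whole statement.\<close>

lemma not_close_wenger:
  assumes "{w,x1,x2,x3,x4,x5,z,t,u,v} \<subseteq> {0..<14}"
   and "far w x1" "far w x2" "far w x3" "far w x4" "far w x5"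
   and "far x1 x2" "far x2 x3" "far x3 x4" "far x4 x5" "far x5 x1"
   and "far z x3" "far t x5" "far v z" "far v t" "far v x3" "far u x1" "far u x2"
   and "near z x2" "near t x4" "near v x4" "near u x5" "near u t" "near u z"
   and "\<not> narrow u x5 x1" "\<not> narrow z x2 x3" "\<not> narrow v x4 x3" "\<not> narrow t x4 x5"
  shows "\<not> close u v"
  unfolding strictly_allowed.simps close_def opposite_close_def narrow_def
  using assms[unfolded strictly_allowed.simps close_def opposite_close_def narrow_def]
  by simp (smt (z3))

lemma strictly_allowed_commute: "strictly_allowed s x y = strictly_allowed s y x"
  by (cases s) (auto simp: abs_minus_commute)

lemma close_commute: "close x y = close y x"
  by (auto simp: close_def abs_minus_commute)

lemma narrow_commute: "narrow x y z = narrow y x z"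
  by (auto simp: narrow_def close_def abs_minus_commute)

lemma strictly_allowed_tilde_edge:
  assumes "\<And>e a b. e \<in> edges (wenger_tilde flip) \<Longrightarrow> e = {a, b} \<Longrightarrow>
      strictly_allowed (sig (wenger_tilde flip) e) (h a) (h b)"
    and "e \<in> tilde_edges flip s" "e = {a, b}"
  shows "strictly_allowed s (h a) (h b)"
proof -
  have "e \<in> edges (wenger_tilde flip)"
    using assms(2) by (cases s) (auto simp: wenger_tilde_simps(2))
  from assms(1)[OF this assms(3)] show ?thesis
    unfolding sig_wenger_tilde[OF assms(2)] .
qed

text \<open>The coloring is pulled back to the mini-gadget along \<open>glue_vertex\<close>. The
  flip at most exchanges x and y, in which \<open>narrow\<close> is symmetric.\<close>

lemma not_narrow_negative_triangle:
  assumes "\<And>x. x \<in> verts (wenger_tilde flip) \<Longrightarrow> h x \<in> {0..<14}"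
    and "\<And>e a b. e \<in> edges (wenger_tilde flip) \<Longrightarrow> e = {a, b} \<Longrightarrow>
      strictly_allowed (sig (wenger_tilde flip) e) (h a) (h b)"
    and t: "(p, q, s) \<in> negative_triangles"
  shows "\<not> narrow (h (Inl p)) (h (Inl q)) (h (Inl s))"
proof -
  define k where "k = h \<circ> glue_vertex (flip (p, q, s)) (p, q, s)"
  have k: "strictly_allowed r (k a) (k b)" if "{a, b} \<in> edges_of_sign r mini_gadget'" for r a b
  proof -
    have e: "glue_vertex (flip (p, q, s)) (p, q, s) ` {a, b} \<in> tilde_edges flip r"
      using that t unfolding tilde_edges_def by blast
    have "strictly_allowed r (h (glue_vertex (flip (p, q, s)) (p, q, s) a))
        (h (glue_vertex (flip (p, q, s)) (p, q, s) b))"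
      by (rule strictly_allowed_tilde_edge[OF assms(2) e]) auto
    then show ?thesis by (simp only: k_def o_apply)
  qed
  have r: "k a \<in> {0..<14}" for a
    using t unfolding k_def o_apply
    by (intro assms(1); cases a) (auto simp: wenger_tilde_simps)
  have "\<not> narrow (k Gx) (k Gy) (k Gz)"
    by (rule not_narrow_mini_gadget[of _ _ _ "k Ga" "k Gb" "k Gc"])
      (use r in \<open>auto intro!: k simp del: strictly_allowed.simps simp: edges_mini_gadget' insert_commute\<close>)
  then show ?thesis
    by (cases "flip (p, q, s)") (auto simp: k_def narrow_commute)
qed

lemma Gamma_graph_simps:
  "verts (Gamma_graph flip) = Inl ` UNIV \<union> Inr ` (negative_triangles \<times> {Ga, Gb, Gc})"
  "edges (Gamma_graph flip) = insert None (Some ` edges (wenger_tilde flip))"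
  "ends (Gamma_graph flip) None = {Inl Wu, Inl Wv}"
  "ends (Gamma_graph flip) (Some e) = e"
  "sig (Gamma_graph flip) None = Minus"
  "sig (Gamma_graph flip) (Some e) = sig (wenger_tilde flip) e"
  by (simp_all add: Gamma_graph_def add_edge_def wenger_tilde_simps)

lemma Gamma_graph_strictly_allowed:
  assumes h: "\<And>x. x \<in> verts (Gamma_graph flip) \<Longrightarrow> h x \<in> {0..<14}"
    and edge: "\<And>e a b. e \<in> edges (Gamma_graph flip) \<Longrightarrow> ends (Gamma_graph flip) e = {a, b} \<Longrightarrow>
      strictly_allowed (sig (Gamma_graph flip) e) (h a) (h b)"
  shows "near (h (Inl Wu)) (h (Inl Wv))" "\<not> close (h (Inl Wu)) (h (Inl Wv))"
proof -
  show "near (h (Inl Wu)) (h (Inl Wv))"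
    using edge[of None "Inl Wu" "Inl Wv"] by (simp only: Gamma_graph_simps) simp
  have edge': "strictly_allowed (sig (wenger_tilde flip) e) (h a) (h b)"
    if "e \<in> edges (wenger_tilde flip)" "e = {a, b}" for e a b
    using edge[of "Some e"] that by (simp only: Gamma_graph_simps) simp
  have nn: "\<not> narrow (h (Inl p)) (h (Inl q)) (h (Inl s))" if "(p, q, s) \<in> negative_triangles" for p q s
    by (rule not_narrow_negative_triangle[OF _ edge' that])
      (use h in \<open>auto simp: Gamma_graph_simps wenger_tilde_simps\<close>)
  have e: "strictly_allowed r (h (Inl a)) (h (Inl b))" if "{a, b} \<in> edges_of_sign r wenger" for r a b
  proof -
    have e: "Inl ` {a, b} \<in> tilde_edges flip r"
      using that unfolding tilde_edges_def by blast
    show ?thesis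
      by (rule strictly_allowed_tilde_edge[OF edge' e]) auto
  qed
  show "\<not> close (h (Inl Wu)) (h (Inl Wv))"
  proof (rule not_close_wenger)
    show "{h (Inl Ww), h (Inl X1), h (Inl X2), h (Inl X3), h (Inl X4), h (Inl X5), h (Inl Wz),
      h (Inl Wt), h (Inl Wu), h (Inl Wv)} \<subseteq> {0..<14}"
      using h by (auto simp: Gamma_graph_simps)
  qed (auto intro!: e nn simp del: strictly_allowed.simps
      simp: edges_of_sign_wenger negative_triangles_def)
qed

section \<open>Graphs with replaced edges and the lower bound for \<Omega>\<close>

lemma replace_edges_simps:
  "verts (replace_edges G d H u v) = Inl ` verts G \<union> Inr ` (edges G \<times> (verts H - {u, v}))"
  "edges (replace_edges G d H u v) = edges G \<times> edges H"
  "ends (replace_edges G d H u v) (e, g) = replace_vertex d u v e ` ends H g"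
  "sig (replace_edges G d H u v) (e, g) = sig H g"
  by (simp_all add: replace_edges_def)

lemma replace_vertex_terminal:
  "replace_vertex d u v e u = Inl (fst (d e))"
  "u \<noteq> v \<Longrightarrow> replace_vertex d u v e v = Inl (snd (d e))"
  by (auto simp: replace_vertex_def)

lemma replace_vertex_in_verts:
  assumes "e \<in> edges G" "x \<in> verts H" "ends G e = {fst (d e), snd (d e)}" "ends G e \<subseteq> verts G"
  shows "replace_vertex d u v e x \<in> verts (replace_edges G d H u v)"
  using assms by (auto simp: replace_vertex_def replace_edges_simps)

lemma complete_graph_simps:
  "verts (complete_graph V) = V" "edges (complete_graph V) = {e. e \<subseteq> V \<and> card e = 2}"
  "ends (complete_graph V) = (\<lambda>e. e)"
  by (simp_all add: complete_graph_def)

lemma glue_vertex_in_verts: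
  assumes "t \<in> negative_triangles"
  shows "glue_vertex b t x \<in> verts (Gamma_graph flip)"
proof -
  obtain p q s where "t = (p, q, s)" by (cases t)
  then show ?thesis
    using assms by (cases x) (simp_all add: Gamma_graph_simps)
qed

lemma Gamma_graph_edge_cases:
  assumes "g \<in> edges (Gamma_graph flip)"
  obtains "g = None"
  | F s where "g = Some (Inl ` F)" "F \<in> edges_of_sign s wenger" "sig (Gamma_graph flip) g = s"
  | t E s where "g = Some (glue_vertex (flip t) t ` E)" "t \<in> negative_triangles"
     "E \<in> edges_of_sign s mini_gadget'" "sig (Gamma_graph flip) g = s"
proof (cases g)
  case None
  then show thesis by (rule that(1))
next
  case (Some e)
  then obtain s where e: "e \<in> tilde_edges flip s"
    using assms by (auto simp: Gamma_graph_simps wenger_tilde_simps)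
  then have s: "sig (Gamma_graph flip) g = s"
    by (simp add: Some Gamma_graph_simps sig_wenger_tilde)
  from e show thesis
  proof (cases rule: tilde_edges_cases)
    case (1 F)
    show thesis by (rule that(2)[of F s]) (use 1 Some s in simp_all)
  next
    case (2 t E)
    show thesis by (rule that(3)[of t E s]) (use 2 Some s in simp_all)
  qed
qed

lemma ends_Gamma_graph_subset:
  assumes "g \<in> edges (Gamma_graph flip)"
  shows "ends (Gamma_graph flip) g \<subseteq> verts (Gamma_graph flip)"
  using assms
proof (cases rule: Gamma_graph_edge_cases)
  case (3 t E s)
  then show ?thesis
    by (simp only: Gamma_graph_simps(4)) (intro image_subsetI glue_vertex_in_verts)
qed (auto simp: Gamma_graph_simps)

lemma Omega_coloring_lower_bound:
  assumes d: "orientation K4 d" and f: "circular_coloring r (Omega_graph flip d) f" and r: "1 \<le> r"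
  shows "14 / 3 \<le> r"
proof (rule ccontr)
  assume "\<not> 14 / 3 \<le> r"
  then have r': "r < 14 / 3" by simp
  define k where "k v = f v * (14 / r)" for v
  have k: "near (k (Inl i)) (k (Inl j)) \<and> \<not> close (k (Inl i)) (k (Inl j))"
    if "i < 4" "j < 4" "i \<noteq> j" for i j :: nat
  proof -
    \<comment> \<open>The embedding of \<Gamma> as the copy placed at the edge ij; composing with it
      gives a coloring of \<Gamma>.\<close>
    define \<rho> :: "wenger_vertex + triangle \<times> gadget_vertex \<Rightarrow> _" where "\<rho> = replace_vertex d (Inl Wu) (Inl Wv) {i, j}"
    have ij: "{i, j} \<in> edges K4" using that by (auto simp: complete_graph_simps)
    then have dij: "{i, j} = {fst (d {i, j}), snd (d {i, j})}"
      using d by (auto simp: orientation_def complete_graph_simps)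
    have in_verts: "\<rho> x \<in> verts (Omega_graph flip d)" if "x \<in> verts (Gamma_graph flip)" for x
      unfolding \<rho>_def Omega_graph_def
      by (rule replace_vertex_in_verts) (use ij dij that \<open>i < 4\<close> \<open>j < 4\<close> in \<open>auto simp: complete_graph_simps\<close>)
    have a: "(k \<circ> \<rho>) x \<in> {0..<14}" if "x \<in> verts (Gamma_graph flip)" for x
    proof -
      have "f (\<rho> x) \<in> {0..<r}"
        using f in_verts[OF that] by (auto simp: circular_coloring_def circle_def)
      then show ?thesis using r by (auto simp: k_def field_simps)
    qed
    have b: "strictly_allowed (sig (Gamma_graph flip) g) ((k \<circ> \<rho>) a) ((k \<circ> \<rho>) b)"
      if "g \<in> edges (Gamma_graph flip)" "ends (Gamma_graph flip) g = {a, b}" for g a b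
    proof -
      have "strictly_allowed (sig (Omega_graph flip d) ({i, j}, g)) (f (\<rho> a) * (14 / r)) (f (\<rho> b) * (14 / r))"
      proof (rule circular_coloring_strict[OF f r r'])
        show "({i, j}, g) \<in> edges (Omega_graph flip d)" "ends (Omega_graph flip d) ({i, j}, g) = {\<rho> a, \<rho> b}"
          using that ij by (simp_all add: Omega_graph_def replace_edges_simps \<rho>_def)
        show "{\<rho> a, \<rho> b} \<subseteq> verts (Omega_graph flip d)"
          using ends_Gamma_graph_subset[OF that(1)] that(2) in_verts by auto
      qed
      then show ?thesis by (simp add: k_def Omega_graph_def replace_edges_simps)
    qed
    have "near (k (\<rho> (Inl Wu))) (k (\<rho> (Inl Wv)))" "\<not> close (k (\<rho> (Inl Wu))) (k (\<rho> (Inl Wv)))"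
      using Gamma_graph_strictly_allowed[of flip "k \<circ> \<rho>", OF a b] by (simp_all only: o_apply not_False_eq_True)
    then have "near (k (Inl (fst (d {i, j})))) (k (Inl (snd (d {i, j}))))"
       "\<not> close (k (Inl (fst (d {i, j})))) (k (Inl (snd (d {i, j}))))"
      by (simp_all add: \<rho>_def replace_vertex_terminal del: strictly_allowed.simps)
    \<comment> \<open>The orientation may list the ends in either order, but both relations are
      symmetric.\<close>
    moreover have "fst (d {i, j}) = i \<and> snd (d {i, j}) = j \<or> fst (d {i, j}) = j \<and> snd (d {i, j}) = i"
      using dij by (auto simp: doubleton_eq_iff)
    ultimately show ?thesis
      using strictly_allowed_commute close_commute by auto
  qed
  have "k (Inl i) \<in> {0..<14}" if "i < 4" for i :: nat
  proof -
    have "Inl i \<in> verts (Omega_graph flip d)"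
      using that by (simp add: Omega_graph_def replace_edges_simps complete_graph_simps)
    then have "f (Inl i) \<in> {0..<r}"
      using f by (auto simp: circular_coloring_def circle_def)
    then show ?thesis using r by (auto simp: k_def field_simps)
  qed
  \<comment> \<open>Three vertices of \<open>K4\<close> suffice: with distances below 4 they lie on
    an arc of length below 4, yet the middle one is at least 2 from both others.\<close>
  from this[of 0] this[of 1] this[of 2] k[of 0 1] k[of 0 2] k[of 1 2] show False
    by (simp add: close_def) (smt (z3))
qed

section \<open>Upper bound\<close>

text \<open>Integer colors on the circle of circumference 14, with the same color 0 at u and
  v.\<close>

fun wenger_color :: "wenger_vertex \<Rightarrow> real" where
  "wenger_color Ww = 6"
| "wenger_color X1 = 3"
| "wenger_color X2 = 9"
| "wenger_color X3 = 3"
| "wenger_color X4 = 10"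
| "wenger_color X5 = 0"
| "wenger_color Wz = 11"
| "wenger_color Wt = 10"
| "wenger_color Wu = 0"
| "wenger_color Wv = 0"

text \<open>The first vertex p of a triangle (p, q, s) identifies it among the four. At the
  triangles of u and t the colors of p and q coincide, so one choice serves both values of b; at
  those of z and v they differ. The last clause is a default.\<close>

fun gadget_color :: "bool \<Rightarrow> wenger_vertex \<Rightarrow> gadget_vertex \<Rightarrow> real" where
  "gadget_color b Wu Ga = 6"
| "gadget_color b Wu Gb = 3"
| "gadget_color b Wu Gc = 0"
| "gadget_color b Wz Ga = (if b then 12 else 8)"
| "gadget_color b Wz Gb = (if b then 5 else 0)"
| "gadget_color b Wz Gc = (if b then 1 else 5)"
| "gadget_color b Wv Ga = (if b then 0 else 6)"
| "gadget_color b Wv Gb = (if b then 6 else 2)"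
| "gadget_color b Wv Gc = (if b then 3 else 13)"
| "gadget_color b Wt Ga = 3"
| "gadget_color b Wt Gb = 0"
| "gadget_color b Wt Gc = 10"
| "gadget_color b p g = 0"

fun Gamma_color :: "(triangle \<Rightarrow> bool) \<Rightarrow> wenger_vertex + triangle \<times> gadget_vertex \<Rightarrow> real" where
  "Gamma_color flip (Inl x) = wenger_color x"
| "Gamma_color flip (Inr (t, g)) = gadget_color (flip t) (fst t) g"

lemma allowed_doubleton:
  assumes "{a, b} = {x, y}" "allowed s (c x) (c y)"
  shows "allowed s (c a) (c b)"
  using assms by (cases s) (auto simp: doubleton_eq_iff abs_minus_commute)

text \<open>As an introduction rule it reads the two ends off a literal edge in the listed order,
  leaving only a numerical goal.\<close>

lemma doubleton_exI: "P x y \<Longrightarrow> \<exists>x' y'. {x, y} = {x', y'} \<and> P x' y'"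
  by blast

lemma wenger_color_allowed:
  "\<forall>F\<in>edges_of_sign s wenger. \<exists>x y. F = {x, y} \<and> allowed s (wenger_color x) (wenger_color y)"
  unfolding edges_of_sign_wenger
  by (cases s; simp only: edges_of_sign_wenger ball_simps; intro conjI TrueI doubleton_exI; simp)

lemma gadget_color_allowed:
  assumes "t \<in> negative_triangles"
  shows "\<forall>E\<in>edges_of_sign s mini_gadget'. \<exists>x y. E = {x, y} \<and>
    allowed s (Gamma_color flip (glue_vertex (flip t) t x)) (Gamma_color flip (glue_vertex (flip t) t y))"
proof -
  consider "t = (Wu,X5,X1)" | "t = (Wz,X2,X3)" | "t = (Wv,X4,X3)" | "t = (Wt,X4,X5)"
    using assms by (auto simp: negative_triangles_def)
  then show ?thesis
  proof cases
  \<comment> \<open>All four triangles are treated alike, for both signs and both values of the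
    flip, edge by edge.\<close>
  qed (cases s; cases "flip t"; simp only: edges_mini_gadget' ball_simps;
      intro conjI TrueI doubleton_exI; simp)+
qed

lemma Gamma_color_range: "Gamma_color flip x \<in> {0..<14}"
proof -
  have w: "wenger_color w \<in> {0..<14}" for w by (cases w) auto
  have g: "gadget_color b p g \<in> {0..<14}" for b p g by (cases p; cases g) auto
  show ?thesis
  proof (cases x)
    case (Inl w)
    then show ?thesis using w[of w] by simp
  next
    case (Inr tg)
    obtain t g' where "tg = (t, g')" by (cases tg)
    then show ?thesis using Inr g[of "flip t" "fst t" g'] by simp
  qed
qed

lemma Gamma_color_allowed:
  assumes "g \<in> edges (Gamma_graph flip)"
  shows "\<exists>x y. ends (Gamma_graph flip) g = {x, y} \<and>
    allowed (sig (Gamma_graph flip) g) (Gamma_color flip x) (Gamma_color flip y)"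
  using assms
proof (cases rule: Gamma_graph_edge_cases)
  case 1
  show ?thesis
    by (rule exI[of _ "Inl Wu"], rule exI[of _ "Inl Wv"]) (simp add: 1 Gamma_graph_simps)
next
  case (2 F s)
  then obtain x y where F: "F = {x, y}" "allowed s (wenger_color x) (wenger_color y)"
    using wenger_color_allowed by blast
  show ?thesis
    by (rule exI[of _ "Inl x"], rule exI[of _ "Inl y"])
      (use 2 F in \<open>simp add: Gamma_graph_simps\<close>)
next
  case (3 t E s)
  then obtain x y where E: "E = {x, y}"
    "allowed s (Gamma_color flip (glue_vertex (flip t) t x)) (Gamma_color flip (glue_vertex (flip t) t y))"
    using gadget_color_allowed by blast
  show ?thesis
    by (rule exI[of _ "glue_vertex (flip t) t x"], rule exI[of _ "glue_vertex (flip t) t y"])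
      (use 3 E in \<open>simp add: Gamma_graph_simps\<close>)
qed

lemma Omega_graph_colorable:
  assumes d: "orientation K4 d"
  shows "\<exists>f. circular_coloring (14 / 3) (Omega_graph flip d) f"
proof -
  define c :: "nat + nat set \<times> (wenger_vertex + triangle \<times> gadget_vertex) \<Rightarrow> real" where
    "c v = (case v of Inl i \<Rightarrow> 0 | Inr (e, x) \<Rightarrow> Gamma_color flip x)" for v
  let ?\<rho> = "replace_vertex d (Inl Wu) (Inl Wv) :: _ \<Rightarrow> wenger_vertex + triangle \<times> gadget_vertex \<Rightarrow> _"
  \<comment> \<open>The color 0 of the vertices of \<open>K4\<close> is the color of both terminals
    of \<Gamma>, so all copies fit together.\<close>
  have c: "c (?\<rho> e x) = Gamma_color flip x" for e x
    by (simp add: c_def replace_vertex_def)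
  have de: "ends K4 e = {fst (d e), snd (d e)}" "ends K4 e \<subseteq> verts K4" if "e \<in> edges K4" for e
    using d that by (auto simp: orientation_def complete_graph_simps)
  have "circular_coloring (14 / 3) (Omega_graph flip d) (\<lambda>v. c v / 3)"
  proof (rule circular_coloring_scaled)
    fix v assume "v \<in> verts (Omega_graph flip d)"
    show "c v \<in> {0..<14}"
    proof (cases v)
      case (Inr ex)
      obtain e x where "ex = (e, x)" by (cases ex)
      then show ?thesis using Inr Gamma_color_range[of flip x] by (simp add: c_def)
    qed (simp add: c_def)
  next
    fix e assume "e \<in> edges (Omega_graph flip d)"
    then have "e \<in> edges K4 \<times> edges (Gamma_graph flip)"
      unfolding Omega_graph_def replace_edges_simps .
    then obtain k g where e: "e = (k, g)" "k \<in> edges K4" "g \<in> edges (Gamma_graph flip)"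
      by (elim SigmaE)
    have ends_e: "ends (Omega_graph flip d) e = ?\<rho> k ` ends (Gamma_graph flip) g"
      by (simp add: e Omega_graph_def replace_edges_simps)
    show "ends (Omega_graph flip d) e \<subseteq> verts (Omega_graph flip d)"
      unfolding ends_e
    proof (rule image_subsetI)
      fix x assume "x \<in> ends (Gamma_graph flip) g"
      then have "x \<in> verts (Gamma_graph flip)" using ends_Gamma_graph_subset[OF e(3)] by (rule subsetD[rotated])
      then show "?\<rho> k x \<in> verts (Omega_graph flip d)"
        unfolding Omega_graph_def by (rule replace_vertex_in_verts[where d = d, OF e(2) _ de[OF e(2)]])
    qed
    fix a b assume ab: "ends (Omega_graph flip d) e = {a, b}"
    obtain x y where xy: "ends (Gamma_graph flip) g = {x, y}"
      "allowed (sig (Gamma_graph flip) g) (Gamma_color flip x) (Gamma_color flip y)"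
      using Gamma_color_allowed[OF e(3)] by blast
    show "allowed (sig (Omega_graph flip d) e) (c a) (c b)"
    proof (rule allowed_doubleton[where c = c])
      show "{a, b} = {?\<rho> k x, ?\<rho> k y}" using ab unfolding ends_e xy by simp
      show "allowed (sig (Omega_graph flip d) e) (c (?\<rho> k x)) (c (?\<rho> k y))"
        using xy(2) by (simp add: c e Omega_graph_def replace_edges_simps)
    qed
  qed
  then show ?thesis by blast
qed

lemma circular_chromatic_number_Omega_graph:
  assumes "orientation K4 d"
  shows "circular_chromatic_number (Omega_graph flip d) = 14 / 3"
  unfolding circular_chromatic_number_def
proof (rule cInf_eq_minimum)
  show "14 / 3 \<in> {r. r \<ge> 1 \<and> (\<exists>f. circular_coloring r (Omega_graph flip d) f)}"
    using Omega_graph_colorable[OF assms] by simp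
qed (use Omega_coloring_lower_bound[OF assms] in blast)

section \<open>Straight-line drawings\<close>

text \<open>The convex hull of the images of the ends is the segment of the edge, written without
  choosing an order of the ends. Loops are excluded by the cardinality condition.\<close>

definition straight_line_drawing :: "('v, 'e, 'm) graph_scheme \<Rightarrow> ('v \<Rightarrow> real \<times> real) \<Rightarrow> bool" where
  "straight_line_drawing G p \<longleftrightarrow> inj_on p (verts G) \<and>
     (\<forall>e\<in>edges G. ends G e \<subseteq> verts G \<and> card (ends G e) = 2) \<and>
     (\<forall>e\<in>edges G. \<forall>x\<in>verts G. p x \<in> convex hull (p ` ends G e) \<longrightarrow> x \<in> ends G e) \<and>
     (\<forall>e\<in>edges G. \<forall>e'\<in>edges G. e \<noteq> e' \<longrightarrow>
        convex hull (p ` ends G e) \<inter> convex hull (p ` ends G e') \<subseteq> p ` (ends G e \<inter> ends G e'))"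

lemma straight_line_drawingD:
  assumes "straight_line_drawing G p"
  shows "inj_on p (verts G)"
    and "e \<in> edges G \<Longrightarrow> ends G e \<subseteq> verts G"
    and "e \<in> edges G \<Longrightarrow> card (ends G e) = 2"
    and "e \<in> edges G \<Longrightarrow> x \<in> verts G \<Longrightarrow> p x \<in> convex hull (p ` ends G e) \<Longrightarrow> x \<in> ends G e"
    and "e \<in> edges G \<Longrightarrow> e' \<in> edges G \<Longrightarrow> e \<noteq> e' \<Longrightarrow>
      convex hull (p ` ends G e) \<inter> convex hull (p ` ends G e') \<subseteq> p ` (ends G e \<inter> ends G e')"
proof -
  note D = assms[unfolded straight_line_drawing_def]
  show "inj_on p (verts G)" using D by (elim conjE)
  show "ends G e \<subseteq> verts G" "card (ends G e) = 2" if "e \<in> edges G"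
    using conjunct1[OF conjunct2[OF D], THEN bspec, OF that] by simp_all
  show "x \<in> ends G e" if "e \<in> edges G" "x \<in> verts G" "p x \<in> convex hull (p ` ends G e)"
    by (rule conjunct1[OF conjunct2[OF conjunct2[OF D]], THEN bspec, OF that(1), THEN bspec, OF that(2),
          THEN mp, OF that(3)])
  show "convex hull (p ` ends G e) \<inter> convex hull (p ` ends G e') \<subseteq> p ` (ends G e \<inter> ends G e')"
    if "e \<in> edges G" "e' \<in> edges G" "e \<noteq> e'"
    by (rule conjunct2[OF conjunct2[OF conjunct2[OF D]], THEN bspec, OF that(1), THEN bspec, OF that(2),
          THEN mp, OF that(3)])
qed

lemma straight_line_drawing_ends:
  assumes "straight_line_drawing G p" "e \<in> edges G"
  obtains a b where "ends G e = {a, b}" "a \<noteq> b" "p a \<noteq> p b"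
proof -
  obtain a b where ab: "ends G e = {a, b}" "a \<noteq> b"
    using straight_line_drawingD(3)[OF assms] unfolding card_2_iff by blast
  have "{a, b} \<subseteq> verts G"
    using straight_line_drawingD(2)[OF assms] ab(1) by simp
  then have "p a \<noteq> p b"
    using inj_onD[OF straight_line_drawingD(1)[OF assms(1)], of a b] ab(2) by auto
  then show thesis using ab by (intro that)
qed

lemma straight_line_drawing_planar:
  assumes "straight_line_drawing G p"
  shows "planar G"
proof -
  have "\<forall>e\<in>edges G. \<exists>\<gamma>. simple_path \<gamma> \<and> {pathstart \<gamma>, pathfinish \<gamma>} = p ` ends G e \<and>
      path_image \<gamma> = convex hull (p ` ends G e)"
  proof
    fix e assume e: "e \<in> edges G"
    obtain a b where "ends G e = {a, b}" "a \<noteq> b" "p a \<noteq> p b"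
      using straight_line_drawing_ends[OF assms e] .
    then show "\<exists>\<gamma>. simple_path \<gamma> \<and> {pathstart \<gamma>, pathfinish \<gamma>} = p ` ends G e \<and>
        path_image \<gamma> = convex hull (p ` ends G e)"
      by (intro exI[of _ "linepath (p a) (p b)"]) (simp add: segment_convex_hull simple_path_linepath)
  qed
  then obtain \<gamma> where \<gamma>: "\<forall>e\<in>edges G. simple_path (\<gamma> e) \<and>
      {pathstart (\<gamma> e), pathfinish (\<gamma> e)} = p ` ends G e \<and>
      path_image (\<gamma> e) = convex hull (p ` ends G e)"
    by (rule bchoice[THEN exE])
  show ?thesis
    unfolding planar_def
  proof (intro exI conjI ballI impI)
    show "inj_on p (verts G)" by (rule straight_line_drawingD(1)[OF assms])
    fix e assume e: "e \<in> edges G"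
    then show "simple_path (\<gamma> e)" "{pathstart (\<gamma> e), pathfinish (\<gamma> e)} = p ` ends G e"
      using \<gamma> by simp_all
    have image: "path_image (\<gamma> k) = convex hull (p ` ends G k)" if "k \<in> edges G" for k
      using \<gamma> that by simp
    have "p ` ends G e \<subseteq> convex hull (p ` ends G e)" by (rule hull_subset)
    then show "path_image (\<gamma> e) \<inter> p ` verts G = p ` ends G e"
      using straight_line_drawingD(2,4)[OF assms e] unfolding image[OF e] by blast
    fix e' assume e': "e' \<in> edges G" "e \<noteq> e'"
    show "path_image (\<gamma> e) \<inter> path_image (\<gamma> e') \<subseteq> p ` (ends G e \<inter> ends G e')"
      unfolding image[OF e] image[OF e'(1)] by (rule straight_line_drawingD(5)[OF assms e e'])
  qed
qed

text \<open>Parallel edges would share their whole segment, in particular its midpoint, which is not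
  the image of an end.\<close>

lemma straight_line_drawing_simple:
  assumes "straight_line_drawing G p"
  shows "simple_graph G"
  unfolding simple_graph_def
proof (intro conjI ballI inj_onI)
  show "card (ends G e) = 2" if "e \<in> edges G" for e
    using assms that by (simp add: straight_line_drawing_def)
  fix e e' assume e: "e \<in> edges G" "e' \<in> edges G" "ends G e = ends G e'"
  show "e = e'"
  proof (rule ccontr)
    assume "e \<noteq> e'"
    obtain a b where ab: "ends G e = {a, b}" "a \<noteq> b" and pab: "p a \<noteq> p b"
      using straight_line_drawing_ends[OF assms e(1)] .
    have "convex hull {p a, p b} \<subseteq> {p a, p b}"
      using straight_line_drawingD(5)[OF assms e(1,2) \<open>e \<noteq> e'\<close>] unfolding e(3)[symmetric] ab by simp
    moreover have "midpoint (p a) (p b) \<in> convex hull {p a, p b}"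
      unfolding segment_convex_hull[symmetric] by (rule midpoint_in_closed_segment)
    ultimately have "midpoint (p a) (p b) = p a \<or> midpoint (p a) (p b) = p b" by blast
    then show False using pab by (simp add: midpoint_eq_endpoint)
  qed
qed

text \<open>The copy of H at the edge e is drawn by \<phi> e inside the image of the convex set
  \<Delta>. Crossings inside one copy are controlled by the drawing of H. Different copies lie in
  images of \<Delta> that meet only in common ends of the replaced edges, hence only in
  terminals.\<close>

lemma straight_line_drawing_replace_edges:
  fixes P :: "'v \<Rightarrow> real \<times> real" and q :: "'w \<Rightarrow> real \<times> real"
  assumes H: "straight_line_drawing H q" "u \<in> verts H" "v \<in> verts H" "u \<noteq> v"
    and G: "\<And>e. e \<in> edges G \<Longrightarrow> ends G e = {fst (d e), snd (d e)}"
      "\<And>e. e \<in> edges G \<Longrightarrow> fst (d e) \<noteq> snd (d e)"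
      "\<And>e. e \<in> edges G \<Longrightarrow> ends G e \<subseteq> verts G"
      "\<And>i. i \<in> verts G \<Longrightarrow> \<exists>e\<in>edges G. i \<in> ends G e"
    and \<phi>: "\<And>e. e \<in> edges G \<Longrightarrow> inj (\<phi> e)"
      "\<And>e. e \<in> edges G \<Longrightarrow> \<phi> e (q u) = P (fst (d e))"
      "\<And>e. e \<in> edges G \<Longrightarrow> \<phi> e (q v) = P (snd (d e))"
      "\<And>e S. e \<in> edges G \<Longrightarrow> convex hull (\<phi> e ` S) = \<phi> e ` (convex hull S)"
    and \<Delta>: "q ` verts H \<subseteq> \<Delta>" "convex \<Delta>"
      "\<And>e e'. e \<in> edges G \<Longrightarrow> e' \<in> edges G \<Longrightarrow> e \<noteq> e' \<Longrightarrow>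
        \<phi> e ` \<Delta> \<inter> \<phi> e' ` \<Delta> \<subseteq> P ` (ends G e \<inter> ends G e')"
  shows "straight_line_drawing (replace_edges G d H u v)
    (case_sum P (\<lambda>(e, x). \<phi> e (q x)))" (is "straight_line_drawing ?\<Omega> ?p")
proof -
  let ?\<rho> = "replace_vertex d u v"
  have p: "?p (?\<rho> e x) = \<phi> e (q x)" if "e \<in> edges G" for e x
    using \<phi>(2,3)[OF that] by (simp add: replace_vertex_def)
  have p_image: "?p ` ?\<rho> e ` S = \<phi> e ` q ` S" if "e \<in> edges G" for e S
    using p[OF that] by (simp add: image_image)
  have q_inj: "x = y" if "q x = q y" "x \<in> verts H" "y \<in> verts H" for x y
    by (rule inj_onD[OF straight_line_drawingD(1)[OF H(1)] that])
  have ends_H: "ends H g \<subseteq> verts H" "card (ends H g) = 2" if "g \<in> edges H" for g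
    using straight_line_drawingD(2,3)[OF H(1) that] by auto
  have on_edge: "x \<in> ends H g" if "q x \<in> convex hull (q ` ends H g)" "g \<in> edges H" "x \<in> verts H" for g x
    by (rule straight_line_drawingD(4)[OF H(1) that(2,3,1)])
  have in_\<Delta>: "convex hull (q ` ends H g) \<subseteq> \<Delta>" if "g \<in> edges H" for g
    using \<Delta>(1,2) ends_H(1)[OF that] by (intro hull_minimal) auto
  have \<rho>_inj: "x = y" if "?\<rho> e x = ?\<rho> e y" "e \<in> edges G" for e x y
    using that G(2)[OF that(2)] by (auto simp: replace_vertex_def split: if_splits)
  have uv: "y \<in> verts H" if "y \<in> {u, v}" for y
    using that H(2,3) by (elim insertE) simp_all
  have terminal: "\<exists>y\<in>{u, v}. ?\<rho> k y = Inl i \<and> P i = \<phi> k (q y)"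
    if "k \<in> edges G" "i \<in> ends G k" for k i
    using that(2) G(1)[OF that(1)] \<phi>(2,3)[OF that(1)] H(4)
    by (auto simp: replace_vertex_def)
  \<comment> \<open>Where two copies meet, both preimages are positions of terminals, and these
    terminals are identified with the same vertex of G.\<close>
  have common: "\<exists>y y'. y \<in> {u, v} \<and> y' \<in> {u, v} \<and> ?\<rho> e y = ?\<rho> e' y' \<and> Y = q y \<and> Y' = q y'"
    if e: "e \<in> edges G" "e' \<in> edges G" "e \<noteq> e'" and Y: "Y \<in> \<Delta>" "Y' \<in> \<Delta>" "\<phi> e Y = \<phi> e' Y'"
    for e e' Y Y'
  proof -
    have "\<phi> e Y \<in> \<phi> e ` \<Delta> \<inter> \<phi> e' ` \<Delta>"
      using imageI[OF Y(1), of "\<phi> e"] imageI[OF Y(2), of "\<phi> e'"] unfolding Y(3) by (rule IntI)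
    then have "\<phi> e Y \<in> P ` (ends G e \<inter> ends G e')" by (rule subsetD[OF \<Delta>(3)[OF e]])
    then obtain i where i: "i \<in> ends G e" "i \<in> ends G e'" "\<phi> e Y = P i" by (elim imageE IntE)
    obtain y where y: "y \<in> {u, v}" "?\<rho> e y = Inl i" "P i = \<phi> e (q y)"
      using terminal[OF e(1) i(1)] by (elim bexE conjE)
    obtain y' where y': "y' \<in> {u, v}" "?\<rho> e' y' = Inl i" "P i = \<phi> e' (q y')"
      using terminal[OF e(2) i(2)] by (elim bexE conjE)
    have "Y = q y" by (rule injD[OF \<phi>(1)[OF e(1)]]) (simp only: i(3) y(3)[symmetric])
    moreover have "Y' = q y'"
      by (rule injD[OF \<phi>(1)[OF e(2)]]) (simp only: i(3) Y(3)[symmetric] y'(3)[symmetric])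
    ultimately show ?thesis using y(1,2) y'(1,2) by (intro exI[of _ y] exI[of _ y'] conjI) simp_all
  qed
  \<comment> \<open>Every vertex belongs to some copy of H; for a vertex of G this holds because it
    is an end of an edge.\<close>
  have verts_\<Omega>: "\<exists>e x. e \<in> edges G \<and> x \<in> verts H \<and> w = ?\<rho> e x" if w: "w \<in> verts ?\<Omega>" for w
  proof (cases w)
    case (Inl i)
    then have "i \<in> verts G" using w by (auto simp: replace_edges_simps)
    then obtain e where e: "e \<in> edges G" "i \<in> ends G e" using G(4) by blast
    obtain y where "y \<in> {u, v}" "?\<rho> e y = Inl i" using terminal[OF e] by blast
    then show ?thesis using e(1) uv Inl by (intro exI[of _ e] exI[of _ y]) simp
  next
    case (Inr ex)
    obtain e x where ex: "ex = (e, x)" by (cases ex)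
    have "e \<in> edges G" "x \<in> verts H" "x \<notin> {u, v}"
      using w by (auto simp: replace_edges_simps Inr ex)
    then show ?thesis
      by (intro exI[of _ e] exI[of _ x]) (simp add: replace_vertex_def Inr ex)
  qed
  have q_\<Delta>: "q x \<in> \<Delta>" if "x \<in> verts H" for x
    using \<Delta>(1) that by (rule subsetD[OF _ imageI])
  show ?thesis
    unfolding straight_line_drawing_def
  proof (intro conjI ballI impI inj_onI)
    fix w w' assume w: "w \<in> verts ?\<Omega>" "w' \<in> verts ?\<Omega>" and eq: "?p w = ?p w'"
    obtain e x where x: "e \<in> edges G" "x \<in> verts H" "w = ?\<rho> e x"
      using verts_\<Omega>[OF w(1)] by (elim exE conjE)
    obtain e' x' where x': "e' \<in> edges G" "x' \<in> verts H" "w' = ?\<rho> e' x'"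
      using verts_\<Omega>[OF w(2)] by (elim exE conjE)
    have eq': "\<phi> e (q x) = \<phi> e' (q x')"
      using eq unfolding x(3) x'(3) p[OF x(1)] p[OF x'(1)] .
    show "w = w'"
    proof (cases "e = e'")
      case True
      have "q x = q x'" by (rule injD[OF \<phi>(1)[OF x(1)]]) (use eq' True in simp)
      then have "x = x'" by (rule q_inj[OF _ x(2) x'(2)])
      then show ?thesis using x(3) x'(3) True by simp
    next
      case False
      obtain y y' where y: "y \<in> {u, v}" "y' \<in> {u, v}" "?\<rho> e y = ?\<rho> e' y'" "q x = q y" "q x' = q y'"
        using common[OF x(1) x'(1) False q_\<Delta>[OF x(2)] q_\<Delta>[OF x'(2)] eq'] by (elim exE conjE)
      have "x = y" by (rule q_inj[OF y(4) x(2) uv[OF y(1)]])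
      moreover have "x' = y'" by (rule q_inj[OF y(5) x'(2) uv[OF y(2)]])
      ultimately show ?thesis using y(3) x(3) x'(3) by simp
    qed
  next
    fix k assume "k \<in> edges ?\<Omega>"
    then have "k \<in> edges G \<times> edges H" unfolding replace_edges_simps .
    then obtain e g where k: "k = (e, g)" "e \<in> edges G" "g \<in> edges H" by (elim SigmaE)
    have ends_k: "ends ?\<Omega> k = ?\<rho> e ` ends H g" unfolding k(1) replace_edges_simps ..
    show "ends ?\<Omega> k \<subseteq> verts ?\<Omega>"
      unfolding ends_k
      by (intro image_subsetI replace_vertex_in_verts[where d = d, OF k(2) _ G(1)[OF k(2)] G(3)[OF k(2)]]
          subsetD[OF ends_H(1)[OF k(3)]])
    have "inj_on (?\<rho> e) (ends H g)" by (rule inj_onI) (rule \<rho>_inj[OF _ k(2)])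
    then show "card (ends ?\<Omega> k) = 2"
      unfolding ends_k using ends_H(2)[OF k(3)] by (simp add: card_image)
    fix w assume w: "w \<in> verts ?\<Omega>" and pw: "?p w \<in> convex hull (?p ` ends ?\<Omega> k)"
    obtain e' x where x: "e' \<in> edges G" "x \<in> verts H" "w = ?\<rho> e' x"
      using verts_\<Omega>[OF w] by (elim exE conjE)
    have "\<phi> e' (q x) \<in> \<phi> e ` (convex hull (q ` ends H g))"
      using pw unfolding ends_k x(3) p_image[OF k(2)] p[OF x(1)] \<phi>(4)[OF k(2)] .
    then obtain Y where Y: "Y \<in> convex hull (q ` ends H g)" "\<phi> e' (q x) = \<phi> e Y" by (elim imageE)
    show "w \<in> ends ?\<Omega> k"
    proof (cases "e' = e")
      case True
      have "q x = Y" by (rule injD[OF \<phi>(1)[OF k(2)]]) (use Y True in simp)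
      then have "x \<in> ends H g" using Y(1) by (intro on_edge[OF _ k(3) x(2)]) simp
      then show ?thesis unfolding ends_k x(3) True by (rule imageI)
    next
      case False
      obtain y y' where y: "y \<in> {u, v}" "y' \<in> {u, v}" "?\<rho> e' y = ?\<rho> e y'" "q x = q y" "Y = q y'"
        using common[OF x(1) k(2) False q_\<Delta>[OF x(2)] subsetD[OF in_\<Delta>[OF k(3)] Y(1)] Y(2)]
        by (elim exE conjE)
      have "x = y" by (rule q_inj[OF y(4) x(2) uv[OF y(1)]])
      moreover have "y' \<in> ends H g"
        by (rule on_edge[OF _ k(3) uv[OF y(2)]]) (use Y(1) y(5) in simp)
      ultimately show ?thesis unfolding ends_k x(3) using y(3) by (intro image_eqI[of _ _ y']) simp_all
    qed
  next
    fix k k' assume "k \<in> edges ?\<Omega>" "k' \<in> edges ?\<Omega>" and ne: "k \<noteq> k'"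
    then have "k \<in> edges G \<times> edges H" "k' \<in> edges G \<times> edges H"
      unfolding replace_edges_simps by simp_all
    then obtain e g e' g' where k: "k = (e, g)" "e \<in> edges G" "g \<in> edges H"
      and k': "k' = (e', g')" "e' \<in> edges G" "g' \<in> edges H" by (elim SigmaE)
    have ends_k: "ends ?\<Omega> k = ?\<rho> e ` ends H g" "ends ?\<Omega> k' = ?\<rho> e' ` ends H g'"
      unfolding k(1) k'(1) replace_edges_simps by (rule refl)+
    show "convex hull (?p ` ends ?\<Omega> k) \<inter> convex hull (?p ` ends ?\<Omega> k') \<subseteq> ?p ` (ends ?\<Omega> k \<inter> ends ?\<Omega> k')"
      unfolding ends_k p_image[OF k(2)] p_image[OF k'(2)] \<phi>(4)[OF k(2)] \<phi>(4)[OF k'(2)]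
    proof (rule subsetI, elim IntE imageE)
      fix X Y Y' assume Y: "Y \<in> convex hull (q ` ends H g)" "X = \<phi> e Y"
        and Y': "Y' \<in> convex hull (q ` ends H g')" "X = \<phi> e' Y'"
      show "X \<in> ?p ` (?\<rho> e ` ends H g \<inter> ?\<rho> e' ` ends H g')"
      proof (cases "e = e'")
        case True
        then have gg': "g \<noteq> g'" using ne k(1) k'(1) by simp
        have "Y = Y'" by (rule injD[OF \<phi>(1)[OF k(2)]]) (use Y(2) Y'(2) True in simp)
        then have "Y \<in> q ` (ends H g \<inter> ends H g')"
          using subsetD[OF straight_line_drawingD(5)[OF H(1) k(3) k'(3) gg'], of Y] Y(1) Y'(1) by simp
        then obtain x where x: "x \<in> ends H g" "x \<in> ends H g'" "Y = q x" by (elim imageE IntE)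
        have "X = ?p (?\<rho> e x)" unfolding p[OF k(2)] Y(2) x(3) ..
        moreover have "?\<rho> e x \<in> ?\<rho> e ` ends H g \<inter> ?\<rho> e' ` ends H g'"
          unfolding True[symmetric] using x(1,2) by (intro IntI imageI)
        ultimately show ?thesis by (rule image_eqI)
      next
        case False
        have eq: "\<phi> e Y = \<phi> e' Y'" using Y(2) Y'(2) by simp
        obtain y y' where y: "y \<in> {u, v}" "y' \<in> {u, v}" "?\<rho> e y = ?\<rho> e' y'" "Y = q y" "Y' = q y'"
          using common[OF k(2) k'(2) False subsetD[OF in_\<Delta>[OF k(3)] Y(1)]
              subsetD[OF in_\<Delta>[OF k'(3)] Y'(1)] eq] by (elim exE conjE)
        \<comment> \<open>A terminal lying on the segment of an edge of H must be one of its ends,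
          so the meeting point is a common end.\<close>
        have "y \<in> ends H g" by (rule on_edge[OF _ k(3) uv[OF y(1)]]) (use Y(1) y(4) in simp)
        moreover have "y' \<in> ends H g'" by (rule on_edge[OF _ k'(3) uv[OF y(2)]]) (use Y'(1) y(5) in simp)
        ultimately have "?\<rho> e y \<in> ?\<rho> e ` ends H g \<inter> ?\<rho> e' ` ends H g'"
          by (intro IntI) (rule imageI, assumption, simp add: y(3))
        moreover have "X = ?p (?\<rho> e y)" unfolding p[OF k(2)] Y(2) y(4) ..
        ultimately show ?thesis by (intro image_eqI)
      qed
    qed
  qed
qed

section \<open>Orientation test for segments\<close>

definition orient :: "'a::comm_ring \<times> 'a \<Rightarrow> 'a \<times> 'a \<Rightarrow> 'a \<times> 'a \<Rightarrow> 'a" where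
  "orient P Q R = (fst Q - fst P) * (snd R - snd P) - (snd Q - snd P) * (fst R - fst P)"

text \<open>\<open>orient P Q\<close> is twice the signed area of a triangle with base PQ, hence
  affine in the third point.\<close>

lemma closed_segment_orient:
  fixes P Q R S X :: "real \<times> real"
  assumes "X \<in> closed_segment R S"
  obtains t where "0 \<le> t" "t \<le> 1" "X = (1 - t) *\<^sub>R R + t *\<^sub>R S"
    "orient P Q X = (1 - t) * orient P Q R + t * orient P Q S"
proof -
  obtain t where t: "0 \<le> t" "t \<le> 1" "X = (1 - t) *\<^sub>R R + t *\<^sub>R S"
    using assms by (auto simp: in_segment)
  have "orient P Q X = (1 - t) * orient P Q R + t * orient P Q S"
    by (simp add: t(3) orient_def algebra_simps)
  with t show thesis by (rule that)
qed

lemma orient_closed_segment_eq_0: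
  fixes P Q X :: "real \<times> real"
  assumes "X \<in> closed_segment P Q"
  shows "orient P Q X = 0"
proof -
  obtain t where "orient P Q X = (1 - t) * orient P Q P + t * orient P Q Q"
    using closed_segment_orient[OF assms] .
  then show ?thesis by (simp add: orient_def)
qed

text \<open>R and S lie strictly on the same side of the line PQ, and so does the segment between
  them.\<close>

lemma closed_segments_disjoint:
  fixes P Q R S :: "real \<times> real"
  assumes "orient P Q R * orient P Q S > 0"
  shows "closed_segment P Q \<inter> closed_segment R S = {}"
proof (rule equals0I)
  fix X assume X: "X \<in> closed_segment P Q \<inter> closed_segment R S"
  then have "X \<in> closed_segment R S" by simp
  then obtain t where t: "0 \<le> t" "t \<le> 1" "orient P Q X = (1 - t) * orient P Q R + t * orient P Q S"
    using closed_segment_orient[of X R S P Q] by metis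
  have 0: "(1 - t) * orient P Q R + t * orient P Q S = 0"
    using t(3) orient_closed_segment_eq_0[of X P Q] X by simp
  \<comment> \<open>After this multiplication both summands are nonnegative: the first is positive
    if t = 0, the second otherwise.\<close>
  have "orient P Q R * ((1 - t) * orient P Q R + t * orient P Q S)
    = (1 - t) * (orient P Q R)\<^sup>2 + t * (orient P Q R * orient P Q S)"
    by (simp add: algebra_simps power2_eq_square)
  moreover have "\<dots> > 0"
  proof (cases "t = 0")
    case True
    have "orient P Q R \<noteq> 0" using assms by auto
    then show ?thesis using True by simp
  next
    case False
    then have "t * (orient P Q R * orient P Q S) > 0" using t(1) by (intro mult_pos_pos[OF _ assms]) simp
    moreover have "(1 - t) * (orient P Q R)\<^sup>2 \<ge> 0" using t(2) by simp
    ultimately show ?thesis by linarith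
  qed
  ultimately show False using 0 by simp
qed

text \<open>At parameter t of the segment PS the orientation is t times a nonzero number, while it
  vanishes on PQ; hence t = 0.\<close>

lemma closed_segments_common_end:
  fixes P Q S :: "real \<times> real"
  assumes "orient P Q S \<noteq> 0"
  shows "closed_segment P Q \<inter> closed_segment P S \<subseteq> {P}"
proof
  fix X assume X: "X \<in> closed_segment P Q \<inter> closed_segment P S"
  then have "X \<in> closed_segment P S" by simp
  then obtain t where t: "X = (1 - t) *\<^sub>R P + t *\<^sub>R S" "orient P Q X = (1 - t) * orient P Q P + t * orient P Q S"
    using closed_segment_orient[of X P S P Q] by metis
  have "t * orient P Q S = 0"
    using t(2) orient_closed_segment_eq_0[of X P Q] X by (simp add: orient_def)
  then show "X \<in> {P}" using t(1) assms by simp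
qed

text \<open>The drawing of \<Gamma> has integer coordinates, so that its orientation tests can be
  evaluated; this carries the results over to the real plane.\<close>

definition real_point :: "int \<times> int \<Rightarrow> real \<times> real" where
  "real_point P = (of_int (fst P), of_int (snd P))"

lemma orient_real_point: "orient (real_point P) (real_point Q) (real_point R) = of_int (orient P Q R)"
  by (simp add: orient_def real_point_def)

lemma inj_real_point: "inj real_point"
  by (auto simp: inj_def real_point_def prod_eq_iff)

text \<open>An executable sufficient test: segments with a common end must not be collinear, and for
  the others one segment must lie strictly on one side of the line through the other.\<close>

fun noncrossing :: "(int \<times> int) \<times> (int \<times> int) \<Rightarrow> (int \<times> int) \<times> (int \<times> int) \<Rightarrow> bool" where
  "noncrossing (P, Q) (R, S) =
    (if P = R then orient P Q S \<noteq> 0 else if P = S then orient P Q R \<noteq> 0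
     else if Q = R then orient Q P S \<noteq> 0 else if Q = S then orient Q P R \<noteq> 0
     else orient P Q R * orient P Q S > 0 \<or> orient R S P * orient R S Q > 0)"

lemma noncrossing_segments:
  assumes "noncrossing (P, Q) (R, S)"
  shows "convex hull (real_point ` {P, Q}) \<inter> convex hull (real_point ` {R, S}) \<subseteq>
    real_point ` ({P, Q} \<inter> {R, S})"
proof -
  have seg: "convex hull (real_point ` {A, B}) = closed_segment (real_point A) (real_point B)" for A B
    by (simp add: segment_convex_hull)
  have common: "closed_segment (real_point A) (real_point B) \<inter> closed_segment (real_point A) (real_point C)
      \<subseteq> {real_point A}" if "orient A B C \<noteq> 0" for A B C
    by (rule closed_segments_common_end) (use that in \<open>simp add: orient_real_point\<close>)
  have disjoint: "closed_segment (real_point A) (real_point B) \<inter> closed_segment (real_point C) (real_point D) = {}"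
    if "orient A B C * orient A B D > 0" for A B C D
    by (rule closed_segments_disjoint)
      (use that in \<open>simp add: orient_real_point flip: of_int_mult\<close>)
  note sym = closed_segment_commute
  consider "P = R" "orient P Q S \<noteq> 0" | "P = S" "orient P Q R \<noteq> 0" | "Q = R" "orient Q P S \<noteq> 0"
    | "Q = S" "orient Q P R \<noteq> 0" | "orient P Q R * orient P Q S > 0" | "orient R S P * orient R S Q > 0"
    using assms by (simp only: noncrossing.simps split: if_splits) blast+
  then show ?thesis
  proof cases
    case 1
    show ?thesis
      unfolding seg using subset_trans[OF common[OF 1(2)], of "real_point ` ({P, Q} \<inter> {R, S})"] 1(1) by simp
  next
    case 2
    show ?thesis
      unfolding seg sym[of "real_point R" "real_point S"]
      using subset_trans[OF common[OF 2(2)], of "real_point ` ({P, Q} \<inter> {R, S})"] 2(1) by simp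
  next
    case 3
    show ?thesis
      unfolding seg sym[of "real_point P" "real_point Q"]
      using subset_trans[OF common[OF 3(2)], of "real_point ` ({P, Q} \<inter> {R, S})"] 3(1) by simp
  next
    case 4
    show ?thesis
      unfolding seg sym[of "real_point P" "real_point Q"] sym[of "real_point R" "real_point S"]
      using subset_trans[OF common[OF 4(2)], of "real_point ` ({P, Q} \<inter> {R, S})"] 4(1) by simp
  next
    case 5
    show ?thesis unfolding seg disjoint[OF 5] by (rule empty_subsetI)
  next
    case 6
    show ?thesis
      unfolding seg Int_commute[of "closed_segment (real_point P) (real_point Q)"] disjoint[OF 6]
      by (rule empty_subsetI)
  qed
qed

text \<open>For two copies of one segment, the orientation tested has a repeated point and
  vanishes.\<close>

lemma noncrossing_distinct:
  assumes "noncrossing (P, Q) (R, S)"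
  shows "{P, Q} \<noteq> {R, S}"
proof
  assume "{P, Q} = {R, S}"
  then have "P = R \<and> Q = S \<or> P = S \<and> Q = R" by (simp only: doubleton_eq_iff)
  then show False using assms by (elim disjE conjE) (simp_all add: orient_def split: if_splits)
qed

section \<open>Affine copies of a triangle\<close>

text \<open>The triangle (0,0), (38,0), (0,38) around the drawing of \<Gamma>, with u, v, z in its
  corners, is carried to P, Q, A.\<close>

definition affine_map :: "real \<times> real \<Rightarrow> real \<times> real \<Rightarrow> real \<times> real \<Rightarrow> real \<times> real \<Rightarrow> real \<times> real" where
  "affine_map P Q A X = P + (fst X / 38) *\<^sub>R (Q - P) + (snd X / 38) *\<^sub>R (A - P)"

lemma convex_hull_affine_map: "convex hull (affine_map P Q A ` S) = affine_map P Q A ` (convex hull S)"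
proof -
  define L where "L X = (fst X / 38) *\<^sub>R (Q - P) + (snd X / 38) *\<^sub>R (A - P)" for X
  have L: "linear L"
    by (rule linearI) (simp_all add: L_def algebra_simps add_divide_distrib)
  have eq: "affine_map P Q A ` T = (+) P ` L ` T" for T
    by (simp add: image_image affine_map_def L_def add.assoc)
  show ?thesis
    unfolding eq convex_hull_translation convex_hull_linear_image[OF L] ..
qed

text \<open>The difference (x, y) of two points with equal images solves a homogeneous linear system
  with determinant \<open>orient P Q A\<close>.\<close>

lemma inj_affine_map:
  assumes "orient P Q A \<noteq> 0"
  shows "inj (affine_map P Q A)"
proof (rule injI)
  fix X Y assume eq: "affine_map P Q A X = affine_map P Q A Y"
  define x y where "x = fst X - fst Y" and "y = snd X - snd Y"
  obtain p1 p2 where P: "P = (p1, p2)" by (cases P)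
  obtain q1 q2 where Q: "Q = (q1, q2)" by (cases Q)
  obtain a1 a2 where A: "A = (a1, a2)" by (cases A)
  have "fst (affine_map P Q A X) = fst (affine_map P Q A Y)" "snd (affine_map P Q A X) = snd (affine_map P Q A Y)"
    using eq by simp_all
  then have e: "x * (q1 - p1) + y * (a1 - p1) = 0" "x * (q2 - p2) + y * (a2 - p2) = 0"
    unfolding affine_map_def P Q A x_def y_def by (simp_all add: field_simps)
  have "x * orient P Q A = 0" "y * orient P Q A = 0"
    using e unfolding orient_def P Q A fst_conv snd_conv by algebra+
  then have "x = 0" "y = 0" using assms by simp_all
  then show "X = Y" by (simp add: x_def y_def prod_eq_iff)
qed

lemma affine_map_corners:
  "affine_map P Q A (0, 0) = P" "affine_map P Q A (38, 0) = Q" "affine_map P Q A (0, 38) = A"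
  by (simp_all add: affine_map_def)

section \<open>Drawing \<open>\<Gamma>\<close> and \<open>\<Omega>\<close>\<close>

text \<open>The coordinates come from Schnyder's algorithm for the triangulation \<open>\<Gamma>\<close> with outer triangle
  u, v, z, followed by rounding to a smaller grid.\<close>

fun wenger_position :: "wenger_vertex \<Rightarrow> int \<times> int" where
  "wenger_position Ww = (20, 10)"
| "wenger_position X1 = (2, 26)"
| "wenger_position X2 = (1, 29)"
| "wenger_position X3 = (28, 9)"
| "wenger_position X4 = (17, 2)"
| "wenger_position X5 = (9, 19)"
| "wenger_position Wz = (0, 38)"
| "wenger_position Wt = (9, 1)"
| "wenger_position Wu = (0, 0)"
| "wenger_position Wv = (38, 0)"

fun gadget_position :: "wenger_vertex \<Rightarrow> gadget_vertex \<Rightarrow> int \<times> int" where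
  "gadget_position Wu Ga = (4, 23)"
| "gadget_position Wu Gb = (4, 20)"
| "gadget_position Wu Gc = (7, 20)"
| "gadget_position Wz Ga = (5, 32)"
| "gadget_position Wz Gb = (3, 33)"
| "gadget_position Wz Gc = (2, 29)"
| "gadget_position Wv Ga = (32, 4)"
| "gadget_position Wv Gb = (30, 3)"
| "gadget_position Wv Gc = (30, 6)"
| "gadget_position Wt Ga = (11, 6)"
| "gadget_position Wt Gb = (12, 2)"
| "gadget_position Wt Gc = (13, 3)"
| "gadget_position p g = (0, 0)"

text \<open>Exchanging x and y in the mini-gadget has the same effect on its unsigned edges as exchanging
  a and c.\<close>

fun mirror :: "gadget_vertex \<Rightarrow> gadget_vertex" where
  "mirror Ga = Gc"
| "mirror Gc = Ga"
| "mirror g = g"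

fun Gamma_position :: "(triangle \<Rightarrow> bool) \<Rightarrow> wenger_vertex + triangle \<times> gadget_vertex \<Rightarrow> int \<times> int" where
  "Gamma_position flip (Inl x) = wenger_position x"
| "Gamma_position flip (Inr (t, g)) = gadget_position (fst t) (if flip t then mirror g else g)"

text \<open>First the 23 edges of the Wenger graph, then for each of the four triangles the 9 gadget
  edges with an inner end. The added edge uv is kept apart. Thanks to \<open>mirror\<close>, the
  same list serves every flip.\<close>

definition tilde_segments :: "((int \<times> int) \<times> (int \<times> int)) list" where
  "tilde_segments =
    [((20, 10), (2, 26)), ((20, 10), (1, 29)), ((20, 10), (28, 9)), ((20, 10), (17, 2)),
     ((20, 10), (9, 19)), ((2, 26), (1, 29)), ((1, 29), (28, 9)), ((28, 9), (17, 2)),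
     ((17, 2), (9, 19)), ((9, 19), (2, 26)), ((0, 38), (28, 9)), ((9, 1), (9, 19)),
     ((38, 0), (0, 38)), ((38, 0), (9, 1)), ((38, 0), (28, 9)), ((0, 0), (2, 26)),
     ((0, 0), (1, 29)), ((0, 38), (1, 29)), ((9, 1), (17, 2)), ((38, 0), (17, 2)),
     ((0, 0), (9, 19)), ((0, 0), (9, 1)), ((0, 0), (0, 38)), ((4, 23), (4, 20)),
     ((4, 20), (7, 20)), ((4, 23), (7, 20)), ((4, 23), (0, 0)), ((4, 23), (2, 26)),
     ((4, 20), (0, 0)), ((4, 20), (9, 19)), ((7, 20), (9, 19)), ((7, 20), (2, 26)),
     ((5, 32), (3, 33)), ((3, 33), (2, 29)), ((5, 32), (2, 29)), ((5, 32), (0, 38)),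
     ((5, 32), (28, 9)), ((3, 33), (0, 38)), ((3, 33), (1, 29)), ((2, 29), (1, 29)),
     ((2, 29), (28, 9)), ((32, 4), (30, 3)), ((30, 3), (30, 6)), ((32, 4), (30, 6)),
     ((32, 4), (38, 0)), ((32, 4), (28, 9)), ((30, 3), (38, 0)), ((30, 3), (17, 2)),
     ((30, 6), (17, 2)), ((30, 6), (28, 9)), ((11, 6), (12, 2)), ((12, 2), (13, 3)),
     ((11, 6), (13, 3)), ((11, 6), (9, 1)), ((11, 6), (9, 19)), ((12, 2), (9, 1)),
     ((12, 2), (17, 2)), ((13, 3), (17, 2)), ((13, 3), (9, 19))]"

text \<open>\<open>sorted_wrt\<close> runs through each pair of the 60 segments once, and the tests
  are evaluated on integers.\<close>

lemma noncrossing_tilde_segments: "sorted_wrt noncrossing (((0, 0), (38, 0)) # tilde_segments)"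
  by code_simp

definition is_segment :: "int \<times> int \<Rightarrow> int \<times> int \<Rightarrow> bool" where
  "is_segment A B \<longleftrightarrow> (A, B) \<in> set tilde_segments \<or> (B, A) \<in> set tilde_segments"

lemma wenger_is_segment:
  "\<forall>F\<in>edges_of_sign s wenger. \<exists>x y. F = {x, y} \<and> is_segment (wenger_position x) (wenger_position y)"
  by (cases s; simp only: edges_of_sign_wenger ball_simps; intro conjI TrueI doubleton_exI;
      simp add: is_segment_def tilde_segments_def)

lemma gadget_is_segment:
  assumes "t \<in> negative_triangles"
  shows "\<forall>E\<in>edges_of_sign s mini_gadget'. \<exists>x y. E = {x, y} \<and>
    is_segment (Gamma_position flip (glue_vertex (flip t) t x)) (Gamma_position flip (glue_vertex (flip t) t y))"
proof -
  consider "t = (Wu,X5,X1)" | "t = (Wz,X2,X3)" | "t = (Wv,X4,X3)" | "t = (Wt,X4,X5)"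
    using assms by (auto simp: negative_triangles_def)
  then show ?thesis
  proof cases
  qed (cases s; cases "flip t"; simp only: edges_mini_gadget' ball_simps;
      intro conjI TrueI doubleton_exI; simp add: is_segment_def tilde_segments_def)+
qed

definition Gamma_vertices :: "(wenger_vertex + triangle \<times> gadget_vertex) list" where
  "Gamma_vertices = map Inl [Ww, X1, X2, X3, X4, X5, Wz, Wt, Wu, Wv] @
     map Inr (List.product [(Wu,X5,X1), (Wz,X2,X3), (Wv,X4,X3), (Wt,X4,X5)] [Ga, Gb, Gc])"

lemma verts_Gamma_graph_subset: "verts (Gamma_graph flip) \<subseteq> set Gamma_vertices"
proof
  fix v assume v: "v \<in> verts (Gamma_graph flip)"
  show "v \<in> set Gamma_vertices"
  proof (cases v)
    case (Inl x)
    then show ?thesis by (cases x) (simp_all add: Gamma_vertices_def)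
  next
    case (Inr tg)
    obtain t g where tg: "tg = (t, g)" by (cases tg)
    have "t \<in> negative_triangles" "g \<in> {Ga, Gb, Gc}"
      using v by (auto simp: Gamma_graph_simps Inr tg)
    then show ?thesis
      unfolding negative_triangles_def Inr tg Gamma_vertices_def
      by (elim insertE emptyE) simp_all
  qed
qed

text \<open>An involution that reduces the positions for an arbitrary flip to those for the constant
  flip False, so that distinctness and range are computed only once.\<close>

fun unflip :: "(triangle \<Rightarrow> bool) \<Rightarrow> wenger_vertex + triangle \<times> gadget_vertex \<Rightarrow> wenger_vertex + triangle \<times> gadget_vertex" where
  "unflip flip (Inl x) = Inl x"
| "unflip flip (Inr (t, g)) = Inr (t, if flip t then mirror g else g)"

lemma mirror_mirror: "mirror (mirror g) = g"
  by (cases g) simp_all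

lemma unflip_unflip: "unflip flip (unflip flip v) = v"
  by (cases "(flip, v)" rule: unflip.cases) (simp_all add: mirror_mirror)

lemma Gamma_position_unflip: "Gamma_position flip v = Gamma_position (\<lambda>_. False) (unflip flip v)"
  by (cases "(flip, v)" rule: unflip.cases) simp_all

lemma unflip_in_verts:
  assumes "v \<in> verts (Gamma_graph flip)"
  shows "unflip flip v \<in> verts (Gamma_graph flip)"
proof (cases v)
  case (Inl x)
  then show ?thesis by (simp add: Gamma_graph_simps)
next
  case (Inr tg)
  obtain t g where tg: "tg = (t, g)" by (cases tg)
  have t: "t \<in> negative_triangles" and g: "g \<in> {Ga, Gb, Gc}"
    using assms by (auto simp: Gamma_graph_simps Inr tg)
  have "(if flip t then mirror g else g) \<in> {Ga, Gb, Gc}"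
    using g by (elim insertE emptyE) simp_all
  then show ?thesis
    unfolding Inr tg unflip.simps Gamma_graph_simps by (intro UnI2 imageI SigmaI t)
qed

lemma inj_on_Gamma_position: "inj_on (Gamma_position flip) (verts (Gamma_graph flip))"
proof (rule inj_onI)
  fix v w assume v: "v \<in> verts (Gamma_graph flip)" and w: "w \<in> verts (Gamma_graph flip)"
    and eq: "Gamma_position flip v = Gamma_position flip w"
  have "distinct (map (Gamma_position (\<lambda>_. False)) Gamma_vertices)"
    by (simp add: Gamma_vertices_def)
  then have "inj_on (Gamma_position (\<lambda>_. False)) (set Gamma_vertices)"
    unfolding distinct_map by (rule conjunct2)
  moreover have "unflip flip v \<in> set Gamma_vertices" "unflip flip w \<in> set Gamma_vertices"
    by (rule subsetD[OF verts_Gamma_graph_subset unflip_in_verts[OF v]])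
      (rule subsetD[OF verts_Gamma_graph_subset unflip_in_verts[OF w]])
  ultimately have "unflip flip v = unflip flip w"
    using eq[unfolded Gamma_position_unflip[of flip]] by (elim inj_onD)
  then have "unflip flip (unflip flip v) = unflip flip (unflip flip w)" by (rule arg_cong)
  then show "v = w" unfolding unflip_unflip .
qed

definition drawing_triangle :: "(real \<times> real) set" where
  "drawing_triangle = convex hull {(0, 0), (38, 0), (0, 38)}"

lemma in_drawing_triangle:
  assumes "0 \<le> x" "0 \<le> y" "x + y \<le> 38"
  shows "(x, y) \<in> drawing_triangle"
proof -
  have "(x, y) = (1 - x / 38 - y / 38) *\<^sub>R (0, 0) + (x / 38) *\<^sub>R (38, 0) + (y / 38) *\<^sub>R (0, 38 :: real)"
    by simp
  moreover have "0 \<le> 1 - x / 38 - y / 38" "0 \<le> x / 38" "0 \<le> y / 38"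
    "1 - x / 38 - y / 38 + x / 38 + y / 38 = 1"
    using assms by (simp_all add: field_simps)
  ultimately show ?thesis
    unfolding drawing_triangle_def convex_hull_3 mem_Collect_eq by (intro exI conjI)
qed

lemma Gamma_position_in_drawing_triangle:
  assumes "v \<in> verts (Gamma_graph flip)"
  shows "real_point (Gamma_position flip v) \<in> drawing_triangle"
proof -
  have "\<forall>v\<in>set Gamma_vertices. 0 \<le> fst (Gamma_position (\<lambda>_. False) v) \<and>
      0 \<le> snd (Gamma_position (\<lambda>_. False) v) \<and>
      fst (Gamma_position (\<lambda>_. False) v) + snd (Gamma_position (\<lambda>_. False) v) \<le> 38"
    by (simp add: Gamma_vertices_def)
  from bspec[OF this subsetD[OF verts_Gamma_graph_subset unflip_in_verts[OF assms]]] show ?thesis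
    unfolding Gamma_position_unflip[of flip] real_point_def
    by (intro in_drawing_triangle) (simp_all flip: of_int_add)
qed

lemma card_edges_of_sign:
  "F \<in> edges_of_sign s wenger \<Longrightarrow> card F = 2" "E \<in> edges_of_sign s mini_gadget' \<Longrightarrow> card E = 2"
proof -
  have "\<forall>F\<in>edges_of_sign s wenger. card F = 2"
    by (cases s; simp only: edges_of_sign_wenger ball_simps; simp)
  then show "F \<in> edges_of_sign s wenger \<Longrightarrow> card F = 2" by (rule bspec)
  have "\<forall>E\<in>edges_of_sign s mini_gadget'. card E = 2"
    by (cases s; simp only: edges_mini_gadget' ball_simps; simp)
  then show "E \<in> edges_of_sign s mini_gadget' \<Longrightarrow> card E = 2" by (rule bspec)
qed

lemma card_ends_Gamma_graph:
  assumes "g \<in> edges (Gamma_graph flip)"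
  shows "card (ends (Gamma_graph flip) g) = 2"
  using assms
proof (cases rule: Gamma_graph_edge_cases)
  case 1
  then show ?thesis by (simp add: Gamma_graph_simps)
next
  case (2 F s)
  have "card (Inl ` F :: (wenger_vertex + triangle \<times> gadget_vertex) set) = card F"
    by (rule card_image) simp
  then show ?thesis using card_edges_of_sign(1)[OF 2(2)] by (simp add: 2(1) Gamma_graph_simps)
next
  case (3 t E s)
  have "card (glue_vertex (flip t) t ` E) = card E"
    by (rule card_image[OF inj_on_subset[OF inj_glue_vertex[OF 3(2)] subset_UNIV]])
  then show ?thesis using card_edges_of_sign(2)[OF 3(3)] by (simp add: 3(1) Gamma_graph_simps)
qed

text \<open>This links the edges of the abstract graph to the explicit list on which the noncrossing
  test was run.\<close>

lemma Gamma_edge_segment: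
  assumes "Some e \<in> edges (Gamma_graph flip)"
  shows "\<exists>A B. (A, B) \<in> set tilde_segments \<and> Gamma_position flip ` e = {A, B}"
proof -
  have seg: ?thesis if "e = {x, y}" "is_segment (Gamma_position flip x) (Gamma_position flip y)" for x y
    using that(2) unfolding is_segment_def
  proof
    assume "(Gamma_position flip x, Gamma_position flip y) \<in> set tilde_segments"
    then show ?thesis using that(1) by (intro exI conjI) (assumption, simp)
  next
    assume "(Gamma_position flip y, Gamma_position flip x) \<in> set tilde_segments"
    then show ?thesis using that(1) by (intro exI conjI) (assumption, simp add: insert_commute)
  qed
  from assms show ?thesis
  proof (cases rule: Gamma_graph_edge_cases)
    case (2 F s)
    obtain x y where F: "F = {x, y}" "is_segment (wenger_position x) (wenger_position y)"
      using bspec[OF wenger_is_segment 2(2)] by (elim exE conjE)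
    show ?thesis by (rule seg[of "Inl x" "Inl y"]) (use 2(1) F in simp_all)
  next
    case (3 t E s)
    obtain x y where E: "E = {x, y}"
      "is_segment (Gamma_position flip (glue_vertex (flip t) t x)) (Gamma_position flip (glue_vertex (flip t) t y))"
      using bspec[OF gadget_is_segment[where flip = flip, OF 3(2)] 3(3)] by (elim exE conjE)
    show ?thesis by (rule seg[OF _ E(2)]) (use 3(1) E(1) in simp)
  qed simp
qed

lemma sorted_wrt_distinct_elements:
  assumes "sorted_wrt R xs" "x \<in> set xs" "y \<in> set xs" "x \<noteq> y"
  shows "R x y \<or> R y x"
proof -
  obtain i j where ij: "i < length xs" "x = xs ! i" "j < length xs" "y = xs ! j"
    using assms(2,3) unfolding in_set_conv_nth by blast
  then have "i \<noteq> j" using assms(4) by auto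
  then consider "i < j" | "j < i" by linarith
  then show ?thesis
    using ij by cases (simp_all add: sorted_wrt_nth_less[OF assms(1)])
qed

lemma Gamma_graph_no_isolated:
  assumes "v \<in> verts (Gamma_graph flip)"
  shows "\<exists>g\<in>edges (Gamma_graph flip). v \<in> ends (Gamma_graph flip) g"
proof -
  have tilde: "Some k \<in> edges (Gamma_graph flip)" if "k \<in> tilde_edges flip s" for k s
    using that by (cases s) (simp_all add: Gamma_graph_simps wenger_tilde_simps)
  have e: "Some (Inl ` F) \<in> edges (Gamma_graph flip)" if "F \<in> edges_of_sign s wenger" for F s
  proof -
    have "Inl ` F \<in> tilde_edges flip s" using that unfolding tilde_edges_def by blast
    then show ?thesis by (rule tilde)
  qed
  have e': "Some (glue_vertex (flip t) t ` E) \<in> edges (Gamma_graph flip)"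
    if "E \<in> edges_of_sign s mini_gadget'" "t \<in> negative_triangles" for E s t
  proof -
    have "glue_vertex (flip t) t ` E \<in> tilde_edges flip s"
      using that unfolding tilde_edges_def by blast
    then show ?thesis by (rule tilde)
  qed
  show ?thesis
  proof (cases v)
    case (Inl x)
    have "\<exists>F. F \<in> edges_of_sign Plus wenger \<and> x \<in> F"
    proof (cases "x \<in> {Wz, Wt, Wu, Wv}")
      case True
      then have "x \<in> {Wz, X3} \<and> {Wz, X3} \<in> edges_of_sign Plus wenger \<or>
          x \<in> {Wt, X5} \<and> {Wt, X5} \<in> edges_of_sign Plus wenger \<or>
          x \<in> {Wu, X1} \<and> {Wu, X1} \<in> edges_of_sign Plus wenger \<or>
          x \<in> {Wv, X3} \<and> {Wv, X3} \<in> edges_of_sign Plus wenger"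
        unfolding edges_of_sign_wenger by (elim insertE emptyE) simp_all
      then show ?thesis by blast
    next
      case False
      then have "x = Ww \<and> {Ww, X1} \<in> edges_of_sign Plus wenger \<or> {Ww, x} \<in> edges_of_sign Plus wenger"
        unfolding edges_of_sign_wenger by (cases x) simp_all
      then show ?thesis by blast
    qed
    then obtain F where F: "F \<in> edges_of_sign Plus wenger" "x \<in> F" by blast
    show ?thesis
      by (rule bexI[OF _ e[OF F(1)]]) (use F(2) Inl in \<open>simp add: Gamma_graph_simps\<close>)
  next
    case (Inr tg)
    obtain t g where tg: "tg = (t, g)" by (cases tg)
    have t: "t \<in> negative_triangles" and g: "g \<in> {Ga, Gb, Gc}"
      using assms by (auto simp: Gamma_graph_simps Inr tg)
    have "v = glue_vertex (flip t) t g"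
      using g Inr tg by (cases t) auto
    moreover have "g \<in> {Ga, Gb} \<and> {Ga, Gb} \<in> edges_of_sign Plus mini_gadget' \<or>
        g \<in> {Gb, Gc} \<and> {Gb, Gc} \<in> edges_of_sign Plus mini_gadget'"
      using g unfolding edges_mini_gadget' by (elim insertE emptyE) simp_all
    then obtain E where E: "E \<in> edges_of_sign Plus mini_gadget'" "g \<in> E" by blast
    ultimately show ?thesis
      by (intro bexI[OF _ e'[OF E(1) t]]) (simp add: Gamma_graph_simps)
  qed
qed

text \<open>A vertex on the segment of e is an end of some edge e'. If e' differs from e, the vertex
  is in the intersection of the two segments, hence a common end. So the condition on vertices
  follows from the condition on crossings.\<close>

lemma straight_line_drawing_no_isolatedI:
  assumes "inj_on p (verts G)"
    and "\<And>e. e \<in> edges G \<Longrightarrow> ends G e \<subseteq> verts G"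
    and "\<And>e. e \<in> edges G \<Longrightarrow> card (ends G e) = 2"
    and crossing: "\<And>e e'. e \<in> edges G \<Longrightarrow> e' \<in> edges G \<Longrightarrow> e \<noteq> e' \<Longrightarrow>
      convex hull (p ` ends G e) \<inter> convex hull (p ` ends G e') \<subseteq> p ` (ends G e \<inter> ends G e')"
    and no_isolated: "\<And>v. v \<in> verts G \<Longrightarrow> \<exists>e\<in>edges G. v \<in> ends G e"
  shows "straight_line_drawing G p"
  unfolding straight_line_drawing_def
proof (intro conjI ballI impI)
  fix e v assume e: "e \<in> edges G" and v: "v \<in> verts G" "p v \<in> convex hull (p ` ends G e)"
  obtain e' where e': "e' \<in> edges G" "v \<in> ends G e'" using no_isolated[OF v(1)] by blast
  show "v \<in> ends G e"
  proof (cases "e = e'")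
    case False
    have "p v \<in> convex hull (p ` ends G e')" using e'(2) by (intro hull_inc imageI)
    then have "p v \<in> p ` (ends G e \<inter> ends G e')"
      using crossing[OF e e'(1) False] v(2) by (intro subsetD[OF crossing[OF e e'(1) False]] IntI)
    then obtain w where w: "p v = p w" "w \<in> ends G e" by (elim imageE IntE)
    have "v = w" by (rule inj_onD[OF assms(1) w(1) v(1) subsetD[OF assms(2)[OF e] w(2)]])
    then show ?thesis using w(2) by simp
  qed (use e'(2) in simp)
qed (fact assms)+

lemma straight_line_drawing_Gamma_graph:
  "straight_line_drawing (Gamma_graph flip) (real_point \<circ> Gamma_position flip)"
proof (rule straight_line_drawing_no_isolatedI)
  let ?pos = "Gamma_position flip"
  show "inj_on (real_point \<circ> ?pos) (verts (Gamma_graph flip))"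
    by (rule comp_inj_on[OF inj_on_Gamma_position inj_on_subset[OF inj_real_point subset_UNIV]])
  have seg_None: "?pos ` ends (Gamma_graph flip) None = {(0, 0), (38, 0)}"
    by (simp add: Gamma_graph_simps)
  have None_Some: "noncrossing ((0, 0), (38, 0)) s" if "s \<in> set tilde_segments" for s
    using noncrossing_tilde_segments that by (simp del: noncrossing.simps)
  fix g g' assume g: "g \<in> edges (Gamma_graph flip)" "g' \<in> edges (Gamma_graph flip)" "g \<noteq> g'"
  have segment: "\<exists>A B. (A, B) \<in> set (((0, 0), (38, 0)) # tilde_segments) \<and>
      ?pos ` ends (Gamma_graph flip) k = {A, B}" if k: "k \<in> edges (Gamma_graph flip)" for k
  proof (cases k)
    case None
    show ?thesis 
      unfolding None seg_None
      by (rule exI[of _ "(0, 0)"], rule exI[of _ "(38, 0)"]) (intro conjI list.set_intros(1) refl)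
  next
    case (Some e)
    obtain A B where AB: "(A, B) \<in> set tilde_segments" "?pos ` e = {A, B}"
      using Gamma_edge_segment[OF k[unfolded Some]] by (elim exE conjE)
    then show ?thesis
      unfolding Some Gamma_graph_simps by (intro exI[of _ A] exI[of _ B] conjI list.set_intros(2))
  qed
  obtain A B where AB: "(A, B) \<in> set (((0, 0), (38, 0)) # tilde_segments)"
    "?pos ` ends (Gamma_graph flip) g = {A, B}" using segment[OF g(1)] by (elim exE conjE)
  obtain C D where CD: "(C, D) \<in> set (((0, 0), (38, 0)) # tilde_segments)"
    "?pos ` ends (Gamma_graph flip) g' = {C, D}" using segment[OF g(2)] by (elim exE conjE)
  \<comment> \<open>The added edge uv is parallel to no other edge, because its segment passes the
    noncrossing test against all the others.\<close>
  have not_both: "?pos ` ends (Gamma_graph flip) None \<noteq> ?pos ` ends (Gamma_graph flip) (Some e)"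
    if e: "Some e \<in> edges (Gamma_graph flip)" for e
  proof -
    obtain A B where AB: "(A, B) \<in> set tilde_segments" "?pos ` e = {A, B}"
      using Gamma_edge_segment[OF e] by (elim exE conjE)
    show ?thesis
      unfolding seg_None Gamma_graph_simps(4) AB(2) by (rule noncrossing_distinct[OF None_Some[OF AB(1)]])
  qed
  \<comment> \<open>Distinct edges occupy distinct entries of the list, so that the pairwise test
    applies to them. Two edges other than uv differ because each is its own set of ends.\<close>
  have "?pos ` ends (Gamma_graph flip) g \<noteq> ?pos ` ends (Gamma_graph flip) g'"
  proof (cases g)
    case None
    then obtain e' where "g' = Some e'" using g(3) by (cases g') simp_all
    then show ?thesis using not_both[of e'] g(2) None by simp
  next
    case (Some e)
    show ?thesis
    proof (cases g')
      case None
      then show ?thesis using not_both[of e] g(1) Some by simp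
    next
      case Some': (Some e')
      have "ends (Gamma_graph flip) g \<noteq> ends (Gamma_graph flip) g'"
        using g(3) unfolding Some Some' Gamma_graph_simps by simp
      then show ?thesis
        unfolding inj_on_image_eq_iff[OF inj_on_Gamma_position ends_Gamma_graph_subset[OF g(1)]
            ends_Gamma_graph_subset[OF g(2)]] .
    qed
  qed
  then have "(A, B) \<noteq> (C, D)"
    unfolding AB(2) CD(2) by (rule contrapos_nn) simp
  then have "noncrossing (A, B) (C, D) \<or> noncrossing (C, D) (A, B)"
    by (rule sorted_wrt_distinct_elements[OF noncrossing_tilde_segments AB(1) CD(1)])
  then have "convex hull (real_point ` {A, B}) \<inter> convex hull (real_point ` {C, D})
      \<subseteq> real_point ` ({A, B} \<inter> {C, D})"
  proof
    assume "noncrossing (C, D) (A, B)"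
    then show ?thesis
      unfolding Int_commute[of "convex hull (real_point ` {A, B})"] Int_commute[of "{A, B}"]
      by (rule noncrossing_segments)
  qed (rule noncrossing_segments)
  then show "convex hull ((real_point \<circ> ?pos) ` ends (Gamma_graph flip) g) \<inter>
      convex hull ((real_point \<circ> ?pos) ` ends (Gamma_graph flip) g') \<subseteq>
      (real_point \<circ> ?pos) ` (ends (Gamma_graph flip) g \<inter> ends (Gamma_graph flip) g')"
    unfolding image_comp[symmetric] AB(2) CD(2)
      inj_on_image_Int[OF inj_on_Gamma_position ends_Gamma_graph_subset[OF g(1)] ends_Gamma_graph_subset[OF g(2)]] .
qed (fact ends_Gamma_graph_subset card_ends_Gamma_graph Gamma_graph_no_isolated)+


section \<open>Six thin triangles along the edges of \<open>K4\<close>\<close>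

definition K4_point :: "nat \<Rightarrow> real \<times> real" where
  "K4_point i = (if i = 0 then (0, 0) else if i = 1 then (36, 0) else if i = 2 then (0, 36) else (12, 12))"

lemma K4_point_simps:
  "K4_point 0 = (0, 0)" "K4_point 1 = (36, 0)" "K4_point (Suc 0) = (36, 0)" "K4_point 2 = (0, 36)"
  "K4_point 3 = (12, 12)"
  by (simp_all add: K4_point_def)

text \<open>The third corners of triangles erected on the edges. Vertex 3 is the centroid of the
  outer triangle 012, and each of the three inner faces receives two of the six triangles. The last
  case is the edge 23.\<close>

definition apex :: "nat set \<Rightarrow> real \<times> real" where
  "apex e = (if e = {0, 1} then (16, 2) else if e = {0, 2} then (2, 16) else if e = {0, 3} then (8, 5)
     else if e = {1, 2} then (17, 17) else if e = {1, 3} then (22, 9) else (5, 22))"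

lemma apex_simps:
  "apex {0, 1} = (16, 2)" "apex {0, 2} = (2, 16)" "apex {0, 3} = (8, 5)"
  "apex {1, 2} = (17, 17)" "apex {1, 3} = (22, 9)" "apex {2, 3} = (5, 22)"
  by (simp_all add: apex_def doubleton_eq_iff)

lemma edges_K4:
  assumes "e \<in> edges K4"
  shows "e \<in> {{0, 1}, {0, 2}, {0, 3}, {1, 2}, {1, 3}, {2, 3}}"
proof -
  have e: "e \<subseteq> {0..<4}" "card e = 2" using assms by (simp_all add: complete_graph_simps)
  obtain a b where ab: "e = {a, b}" "a \<noteq> b" using e(2) unfolding card_2_iff by blast
  then have less: "a < 4" "b < 4" using e(1) by simp_all
  have *: "{a, b} \<in> {{0, 1}, {0, 2}, {0, 3}, {1, 2}, {1, 3}, {2, 3}}" if "a < b" "b < 4" for a b :: nat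
  proof -
    have "a = 0 \<and> b = 1 \<or> a = 0 \<and> b = 2 \<or> a = 0 \<and> b = 3 \<or> a = 1 \<and> b = 2 \<or> a = 1 \<and> b = 3 \<or> a = 2 \<and> b = 3"
      using that by linarith
    then show ?thesis by (elim disjE conjE) simp_all
  qed
  show ?thesis
  proof (cases "a < b")
    case True
    show ?thesis unfolding ab(1) by (rule *[OF True less(2)])
  next
    case False
    then have "b < a" using ab(2) by simp
    show ?thesis unfolding ab(1) insert_commute[of a b] by (rule *[OF \<open>b < a\<close> less(1)])
  qed
qed

definition K4_region :: "nat set \<Rightarrow> (real \<times> real) set" where
  "K4_region e = convex hull (insert (apex e) (K4_point ` e))"

lemma K4_region_weights:
  assumes "X \<in> K4_region {i, j}"
  obtains a b c where "0 \<le> a" "0 \<le> b" "0 \<le> c" "a + b + c = 1"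
    "fst X = a * fst (apex {i, j}) + b * fst (K4_point i) + c * fst (K4_point j)"
    "snd X = a * snd (apex {i, j}) + b * snd (K4_point i) + c * snd (K4_point j)"
proof -
  have "X \<in> convex hull {apex {i, j}, K4_point i, K4_point j}"
    using assms by (simp add: K4_region_def)
  then obtain a b c where "0 \<le> a" "0 \<le> b" "0 \<le> c" "a + b + c = 1"
    "X = a *\<^sub>R apex {i, j} + b *\<^sub>R K4_point i + c *\<^sub>R K4_point j"
    unfolding convex_hull_3 mem_Collect_eq by (elim exE conjE)
  then show thesis by (intro that[of a b c]) simp_all
qed


text \<open>For each region, the three inequalities are those of the lines through the sides of the
  triangle; they are linear in the convex weights of the corners.\<close>

lemma K4_region_halfplanes:
  assumes "e \<in> edges K4" "X \<in> K4_region e"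
  shows "e = {0, 1} \<and> 0 \<le> snd X \<and> 8 * snd X \<le> fst X \<and> fst X + 10 * snd X \<le> 36 \<or>
    e = {0, 2} \<and> 0 \<le> fst X \<and> 8 * fst X \<le> snd X \<and> 10 * fst X + snd X \<le> 36 \<or>
    e = {0, 3} \<and> snd X \<le> fst X \<and> 5 * fst X \<le> 8 * snd X \<and> 7 * fst X \<le> 36 + 4 * snd X \<or>
    e = {1, 2} \<and> fst X + snd X \<le> 36 \<and> 612 \<le> 19 * fst X + 17 * snd X \<and> 612 \<le> 17 * fst X + 19 * snd X \<or>
    e = {1, 3} \<and> 36 \<le> fst X + 2 * snd X \<and> 3 * fst X + 10 * snd X \<le> 156 \<and> 9 * fst X + 14 * snd X \<le> 324 \<or>
    e = {2, 3} \<and> 2 * fst X + snd X \<le> 36 \<and> 204 \<le> 10 * fst X + 7 * snd X \<and> 180 \<le> 14 * fst X + 5 * snd X"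
proof -
  note w = K4_region_weights[where X = X]
  show ?thesis
    using edges_K4[OF assms(1)]
  proof (elim insertE emptyE)
    assume e: "e = {0, 1}"
    show ?thesis by (rule w[OF assms(2)[unfolded e]], simp only: apex_simps K4_point_simps fst_conv snd_conv) (simp add: e)
  next
    assume e: "e = {0, 2}"
    show ?thesis by (rule w[OF assms(2)[unfolded e]], simp only: apex_simps K4_point_simps fst_conv snd_conv) (simp add: e)
  next
    assume e: "e = {0, 3}"
    show ?thesis by (rule w[OF assms(2)[unfolded e]], simp only: apex_simps K4_point_simps fst_conv snd_conv) (simp add: e)
  next
    assume e: "e = {1, 2}"
    show ?thesis by (rule w[OF assms(2)[unfolded e]], simp only: apex_simps K4_point_simps fst_conv snd_conv) (simp add: e)
  next
    assume e: "e = {1, 3}"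
    show ?thesis by (rule w[OF assms(2)[unfolded e]], simp only: apex_simps K4_point_simps fst_conv snd_conv) (simp add: e)
  next
    assume e: "e = {2, 3}"
    show ?thesis by (rule w[OF assms(2)[unfolded e]], simp only: apex_simps K4_point_simps fst_conv snd_conv) (simp add: e)
  qed
qed

text \<open>For disjoint edges the two systems of inequalities contradict each other; for adjacent
  ones they leave only the common vertex.\<close>

lemma K4_regions_meet:
  assumes "e \<in> edges K4" "e' \<in> edges K4" "e \<noteq> e'" "X \<in> K4_region e" "X \<in> K4_region e'"
  shows "X \<in> K4_point ` (e \<inter> e')"
  using K4_region_halfplanes[OF assms(1,4)] K4_region_halfplanes[OF assms(2,5)]
  by (elim disjE conjE; use assms(3) in \<open>simp add: K4_point_simps prod_eq_iff\<close>; linarith?)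

text \<open>Simplicity makes \<open>ends G\<close> an injection of the edges into the power set of
  the finite vertex set.\<close>

lemma straight_line_drawing_finite_graph:
  assumes "straight_line_drawing G p" "finite (verts G)"
  shows "finite_graph G"
proof -
  have "ends G ` edges G \<subseteq> Pow (verts G)"
    using straight_line_drawingD(2)[OF assms(1)] by (intro image_subsetI PowI)
  then have "finite (ends G ` edges G)"
    by (rule finite_subset) (simp add: assms(2))
  moreover have "inj_on (ends G) (edges G)"
    using straight_line_drawing_simple[OF assms(1)] unfolding simple_graph_def by (rule conjunct2)
  ultimately have "finite (edges G)" by (rule finite_imageD)
  then show ?thesis
    unfolding finite_graph_def using assms(2) straight_line_drawingD(2,3)[OF assms(1)] by simp
qed

lemma K4_triangle_nondegenerate:
  assumes "{a, b} \<in> edges K4"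
  shows "orient (K4_point a) (K4_point b) (apex {a, b}) \<noteq> 0"
proof -
  have *: ?thesis if eq: "{a, b} = {i, j}" and "orient (K4_point i) (K4_point j) (apex {i, j}) \<noteq> 0"
      "orient (K4_point j) (K4_point i) (apex {i, j}) \<noteq> 0" for i j
  proof -
    have "a = i \<and> b = j \<or> a = j \<and> b = i" using eq by (simp add: doubleton_eq_iff)
    then show ?thesis unfolding eq using that(2,3) by (elim disjE conjE) simp_all
  qed
  show ?thesis
    using edges_K4[OF assms]
    by (elim insertE emptyE) (erule *; simp add: apex_simps[simplified] K4_point_simps orient_def)+
qed

text \<open>The region depends only on the set {a, b}, so either orientation of the edge fills the
  same triangle.\<close>

lemma affine_map_drawing_triangle:
  "affine_map (K4_point a) (K4_point b) (apex {a, b}) ` drawing_triangle = K4_region {a, b}"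
proof -
  have "affine_map (K4_point a) (K4_point b) (apex {a, b}) ` {(0, 0), (38, 0), (0, 38)} =
      insert (apex {a, b}) (K4_point ` {a, b})"
    by (simp only: image_insert image_empty affine_map_corners insert_commute)
  then show ?thesis
    unfolding drawing_triangle_def K4_region_def convex_hull_affine_map[symmetric] by simp
qed

lemma straight_line_drawing_Omega_graph:
  assumes d: "orientation K4 d"
  shows "\<exists>p. straight_line_drawing (Omega_graph flip d) p"
proof -
  define \<phi> where "\<phi> e = affine_map (K4_point (fst (d e))) (K4_point (snd (d e))) (apex e)" for e
  have de: "e = {fst (d e), snd (d e)}" if "e \<in> edges K4" for e
    using d that unfolding orientation_def complete_graph_simps by simp
  have region: "\<phi> e ` drawing_triangle = K4_region e" if "e \<in> edges K4" for e
    using affine_map_drawing_triangle[of "fst (d e)" "snd (d e)"] unfolding \<phi>_def de[OF that, symmetric] .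
  have "straight_line_drawing (replace_edges K4 d (Gamma_graph flip) (Inl Wu) (Inl Wv))
    (case_sum K4_point (\<lambda>(e, x). \<phi> e ((real_point \<circ> Gamma_position flip) x)))"
  proof (rule straight_line_drawing_replace_edges[where \<Delta> = drawing_triangle])
    show "straight_line_drawing (Gamma_graph flip) (real_point \<circ> Gamma_position flip)"
      by (rule straight_line_drawing_Gamma_graph)
    show "Inl Wu \<in> verts (Gamma_graph flip)" "Inl Wv \<in> verts (Gamma_graph flip)"
      by (simp_all add: Gamma_graph_simps)
    show "(Inl Wu :: wenger_vertex + triangle \<times> gadget_vertex) \<noteq> Inl Wv" by simp
    show "(real_point \<circ> Gamma_position flip) ` verts (Gamma_graph flip) \<subseteq> drawing_triangle"
      by (rule image_subsetI) (simp only: o_apply Gamma_position_in_drawing_triangle)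
    show "convex drawing_triangle" by (simp add: drawing_triangle_def)
    show "\<exists>e\<in>edges K4. i \<in> ends K4 e" if "i \<in> verts K4" for i
      using that
      by (intro bexI[of _ "{i, if i = 0 then 1 else 0}"]) (simp_all add: complete_graph_simps)
    fix e assume e: "e \<in> edges K4"
    show "ends K4 e = {fst (d e), snd (d e)}" using de[OF e] by (simp add: complete_graph_simps)
    have "card e = 2" "e \<subseteq> verts K4" using e by (simp_all add: complete_graph_simps)
    then show "ends K4 e \<subseteq> verts K4" by (simp add: complete_graph_simps)
    show "fst (d e) \<noteq> snd (d e)"
    proof
      assume "fst (d e) = snd (d e)"
      then have "e = {snd (d e)}" using de[OF e] by simp
      then have "card e = 1" by (metis card_1_singleton_iff One_nat_def)
      then show False using \<open>card e = 2\<close> by simp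
    qed
    show "inj (\<phi> e)"
      unfolding \<phi>_def
      by (rule inj_affine_map)
        (rule K4_triangle_nondegenerate[of "fst (d e)" "snd (d e)", unfolded de[OF e, symmetric], OF e])
    show "\<phi> e ((real_point \<circ> Gamma_position flip) (Inl Wu)) = K4_point (fst (d e))"
      "\<phi> e ((real_point \<circ> Gamma_position flip) (Inl Wv)) = K4_point (snd (d e))"
      by (simp_all add: \<phi>_def real_point_def affine_map_corners)
    show "convex hull (\<phi> e ` S) = \<phi> e ` (convex hull S)" for S
      unfolding \<phi>_def by (rule convex_hull_affine_map)
    fix e' assume e': "e' \<in> edges K4" "e \<noteq> e'"
    show "\<phi> e ` drawing_triangle \<inter> \<phi> e' ` drawing_triangle \<subseteq> K4_point ` (ends K4 e \<inter> ends K4 e')"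
      unfolding region[OF e] region[OF e'(1)] complete_graph_simps
      by (rule subsetI, elim IntE) (rule K4_regions_meet[OF e e'])
  qed
  then show ?thesis unfolding Omega_graph_def by (intro exI)
qed

lemma finite_verts_Omega_graph: "finite (verts (Omega_graph flip d))"
proof -
  have "finite (verts (Gamma_graph flip))"
    by (rule finite_subset[OF verts_Gamma_graph_subset finite_set])
  moreover have "finite (edges K4)"
    by (rule finite_subset[of _ "Pow {0..<4}"]) (auto simp: complete_graph_simps)
  ultimately show ?thesis
    by (simp add: Omega_graph_def replace_edges_simps complete_graph_simps(1))
qed

theorem theorem6p8:
  fixes flip :: "triangle \<Rightarrow> bool"
    and d :: "nat set \<Rightarrow> nat \<times> nat"
  assumes "orientation K4 d"
  shows "finite_graph (Omega_graph flip d) \<and> simple_graph (Omega_graph flip d) \<and>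
    planar (Omega_graph flip d) \<and>
    circular_chromatic_number (Omega_graph flip d) = 14 / 3"
proof -
  obtain p where p: "straight_line_drawing (Omega_graph flip d) p"
    using straight_line_drawing_Omega_graph[OF assms] by (rule exE)
  show ?thesis
    using straight_line_drawing_finite_graph[OF p finite_verts_Omega_graph]
      straight_line_drawing_simple[OF p] straight_line_drawing_planar[OF p]
      circular_chromatic_number_Omega_graph[OF assms] by (intro conjI)
qed

end
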